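(* Let $\mathcal{C},\mathcal{D}$ be coverings of $\mathbb{R}^2$ by complete folding curves which both satisfy the local isomorphism property. Then $\mathcal{C}$ and $\mathcal{D}$ are locally isomorphic if and only if, for each curve $C\in\mathcal{C}$ and each curve $D\in\mathcal{D}$, $C$ and $D$ have the same type and their associated sequences are locally isomorphic.
   Context: All sequences take values in $\{+1,-1\}$. For $S=(a_1,\dots,a_n)$ write $\overline{S}=(-a_n,\dots,-a_1)$. The $n$-folding sequences are defined recursively: the only $0$-folding sequence is the empty sequence, and the $(n+1)$-folding sequences are exactly $(\overline{S},+1,S)$ and $(\overline{S},-1,S)$ with $S$ an $n$-folding sequence. A subword of a sequence $(b_k)$ is a block $(b_{h+1},\dots,b_{h+m})$. A complete folding sequence is a sequence $(a_k)_{k\in\mathbb{Z}}$ each finite subword of which is a subword of some $n$-folding sequence. Two sequences indexed by $\mathbb{Z}$ are locally isomorphic if they have the same finite subwords. For a complete folding sequence $S=(a_h)$ there is $h_1\in\mathbb{Z}$ with $a_{h_1+4k}=(-1)^k a_{h_1}$ for all $k$; the set $E_1(S)=h_1+2\mathbb{Z}$ does not depend on the choice of $h_1$. A segment is an oriented unit edge of $\mathbb{Z}^2$. A complete curve is a sequence $C=(C_i)_{i\in\mathbb{Z}}$ of segments such that the terminal point of $C_i$ is the initial point of $C_{i+1}$, consecutive supports are perpendicular, and all supports are pairwise distinct (curves differing by an index shift are identified). Its associated sequence is $(\eta_i)_{i\in\mathbb{Z}}$ with $\eta_i=+1$ (resp. $-1$) if one turns left (resp. right) from $C_i$ to $C_{i+1}$.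 A complete folding curve is a complete curve whose associated sequence $S$ is a complete folding sequence; it has type $H$ (resp. $V$) if all the segments $C_i$ with $i\in E_1(S)$ have horizontal (resp. vertical) supports (one of the two always holds). A covering of $\mathbb{R}^2$ by complete folding curves is a set $\mathcal{C}$ of complete folding curves such that every unit edge of the lattice $\mathbb{Z}^2$ is the support of exactly one segment of exactly one curve of $\mathcal{C}$. A decorated segment of $\mathcal{C}$ is a segment of a curve of $\mathcal{C}$ together with, at each of its endpoints, the support of the segment of the same curve which precedes/follows it there. $\mathcal{C}$ satisfies the local isomorphism property if for every finite set $F$ of decorated segments of $\mathcal{C}$ there is $r>0$ such that every disk of radius $r$ contains a translate $v+F$ ($v\in\mathbb{Z}^2$) which is a set of decorated segments of $\mathcal{C}$. Two coverings are locally isomorphic if every finite set of decorated segments of either one is a translate of a set of decorated segments of the other. *)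

theory Defs
  imports "HOL-Analysis.Analysis" "HOL-Library.Sublist"
begin

section \<open>Folding sequences\<close>

definition bar :: "int list \<Rightarrow> int list" where
  "bar S = map uminus (rev S)"

fun folding_seqs :: "nat \<Rightarrow> int list set" where
  "folding_seqs 0 = {[]}"
| "folding_seqs (Suc n) = {bar S @ [c] @ S | S c. S \<in> folding_seqs n \<and> c \<in> {1, -1}}"

definition subwords :: "(int \<Rightarrow> int) \<Rightarrow> int list set" where
  "subwords a = {map (\<lambda>j. a (h + int j)) [1..<Suc m] | h m. True}"

definition complete_folding_seq :: "(int \<Rightarrow> int) \<Rightarrow> bool" where
  "complete_folding_seq a \<longleftrightarrow> (\<forall>w \<in> subwords a. \<exists>n. \<exists>S \<in> folding_seqs n. sublist w S)"

definition seq_locally_isomorphic :: "(int \<Rightarrow> int) \<Rightarrow> (int \<Rightarrow> int) \<Rightarrow> bool" where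
  "seq_locally_isomorphic a b \<longleftrightarrow> subwords a = subwords b"

text \<open>
  The set \<open>h\<^sub>1 + 2\<int>\<close>, where \<open>a (h\<^sub>1 + 4k) = (-1)\<^sup>k a h\<^sub>1\<close> for all \<open>k\<close>. For a complete folding
  sequence it is the same set for every admissible \<open>h\<^sub>1\<close>, so taking the union over all of them
  avoids a choice.
\<close>
definition E1 :: "(int \<Rightarrow> int) \<Rightarrow> int set" where
  "E1 a = {h + 2 * l | h l. \<forall>k. a (h + 4 * k) = (if even k then a h else - a h)}"

section \<open>Curves\<close>

type_synonym point = "int \<times> int"
type_synonym seg = "point \<times> point"

text \<open>
  A segment is the pair of its initial and terminal point; the unit edge supporting it is
  represented by the set of its two endpoints.
\<close>
definition direction :: "seg \<Rightarrow> int \<times> int" where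
  "direction s = snd s - fst s"

definition is_segment :: "seg \<Rightarrow> bool" where
  "is_segment s \<longleftrightarrow> direction s \<in> {(1, 0), (-1, 0), (0, 1), (0, -1)}"

definition seg_support :: "seg \<Rightarrow> point set" where
  "seg_support s = {fst s, snd s}"

definition unit_edges :: "point set set" where
  "unit_edges = {seg_support s | s. is_segment s}"

definition horizontal :: "seg \<Rightarrow> bool" where
  "horizontal s \<longleftrightarrow> snd (fst s) = snd (snd s)"

definition vertical :: "seg \<Rightarrow> bool" where
  "vertical s \<longleftrightarrow> fst (fst s) = fst (snd s)"

definition perpendicular :: "seg \<Rightarrow> seg \<Rightarrow> bool" where
  "perpendicular s t \<longleftrightarrow>
     fst (direction s) * fst (direction t) + snd (direction s) * snd (direction t) = 0"

definition rotate_left :: "int \<times> int \<Rightarrow> int \<times> int" where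
  "rotate_left d = (- snd d, fst d)"

definition complete_curve :: "(int \<Rightarrow> seg) \<Rightarrow> bool" where
  "complete_curve C \<longleftrightarrow>
     (\<forall>i. is_segment (C i) \<and> snd (C i) = fst (C (i + 1)) \<and> perpendicular (C i) (C (i + 1))) \<and>
     inj (\<lambda>i. seg_support (C i))"

definition assoc_seq :: "(int \<Rightarrow> seg) \<Rightarrow> int \<Rightarrow> int" where
  "assoc_seq C i = (if direction (C (i + 1)) = rotate_left (direction (C i)) then 1 else -1)"

definition complete_folding_curve :: "(int \<Rightarrow> seg) \<Rightarrow> bool" where
  "complete_folding_curve C \<longleftrightarrow> complete_curve C \<and> complete_folding_seq (assoc_seq C)"

definition type_H :: "(int \<Rightarrow> seg) \<Rightarrow> bool" where
  "type_H C \<longleftrightarrow> (\<forall>i \<in> E1 (assoc_seq C). horizontal (C i))"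

definition type_V :: "(int \<Rightarrow> seg) \<Rightarrow> bool" where
  "type_V C \<longleftrightarrow> (\<forall>i \<in> E1 (assoc_seq C). vertical (C i))"

definition same_type :: "(int \<Rightarrow> seg) \<Rightarrow> (int \<Rightarrow> seg) \<Rightarrow> bool" where
  "same_type C D \<longleftrightarrow> (type_H C \<and> type_H D) \<or> (type_V C \<and> type_V D)"

section \<open>Coverings\<close>

text \<open>
  Curves are considered up to a shift of the index. A covering is given by a set of
  parametrized curves containing one parametrization of each of its curves: since a pair
  \<open>(C, i)\<close> is required to be unique, no two members of a covering are shifts of each other
  (lemma \<open>covering_shift_unique\<close>). The notions used below do not depend on the
  parametrizations (the \<open>shift\<close> lemmas).
\<close>
definition covering :: "(int \<Rightarrow> seg) set \<Rightarrow> bool" where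
  "covering \<C> \<longleftrightarrow>
     (\<forall>C \<in> \<C>. complete_folding_curve C) \<and>
     (\<forall>e \<in> unit_edges. \<exists>!p. fst p \<in> \<C> \<and> seg_support ((fst p) (snd p)) = e)"

text \<open>
  A decorated segment is a segment together with the supports of the segment preceding it (at
  its initial point) and of the segment following it (at its terminal point).
\<close>
type_synonym decorated = "seg \<times> point set \<times> point set"

definition decorated_segments :: "(int \<Rightarrow> seg) set \<Rightarrow> decorated set" where
  "decorated_segments \<C> =
     {(C i, seg_support (C (i - 1)), seg_support (C (i + 1))) | C i. C \<in> \<C>}"

definition translate :: "point \<Rightarrow> decorated \<Rightarrow> decorated" where
  "translate v = (\<lambda>((p, q), A, B). ((v + p, v + q), (+) v ` A, (+) v ` B))"

definition vertices :: "decorated \<Rightarrow> point set" where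
  "vertices = (\<lambda>(s, A, B). seg_support s \<union> A \<union> B)"

definition to_plane :: "point \<Rightarrow> real \<times> real" where
  "to_plane p = (real_of_int (fst p), real_of_int (snd p))"

text \<open>Disks are convex, so a disk contains an edge as soon as it contains its endpoints.\<close>
definition local_isomorphism_property :: "(int \<Rightarrow> seg) set \<Rightarrow> bool" where
  "local_isomorphism_property \<C> \<longleftrightarrow>
     (\<forall>F. finite F \<and> F \<subseteq> decorated_segments \<C> \<longrightarrow>
        (\<exists>r>0. \<forall>c. \<exists>v.
           translate v ` F \<subseteq> decorated_segments \<C> \<and>
           (\<forall>d \<in> translate v ` F. to_plane ` vertices d \<subseteq> cball c r)))"

definition locally_isomorphic :: "(int \<Rightarrow> seg) set \<Rightarrow> (int \<Rightarrow> seg) set \<Rightarrow> bool" where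
  "locally_isomorphic \<C> \<D> \<longleftrightarrow>
     (\<forall>F. finite F \<and> F \<subseteq> decorated_segments \<C> \<longrightarrow>
        (\<exists>v. translate v ` F \<subseteq> decorated_segments \<D>)) \<and>
     (\<forall>F. finite F \<and> F \<subseteq> decorated_segments \<D> \<longrightarrow>
        (\<exists>v. translate v ` F \<subseteq> decorated_segments \<C>))"

section \<open>Independence of the parametrization\<close>

definition shift :: "int \<Rightarrow> (int \<Rightarrow> 'a) \<Rightarrow> int \<Rightarrow> 'a" where
  "shift k C = (\<lambda>i. C (i + k))"

lemma covering_shift_unique:
  assumes "covering \<C>" "C \<in> \<C>" "shift k C \<in> \<C>"
  shows "k = 0"
proof -
  have "is_segment (C k)"
    using assms by (auto simp: covering_def complete_folding_curve_def complete_curve_def)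
  then have "seg_support (C k) \<in> unit_edges"
    unfolding unit_edges_def by blast
  then have "\<exists>!p. fst p \<in> \<C> \<and> seg_support ((fst p) (snd p)) = seg_support (C k)"
    using assms(1) by (auto simp: covering_def)
  moreover have "fst (C, k) \<in> \<C> \<and> seg_support (fst (C, k) (snd (C, k))) = seg_support (C k)"
    using assms by simp
  moreover have "fst (shift k C, 0) \<in> \<C> \<and>
      seg_support (fst (shift k C, 0) (snd (shift k C, 0))) = seg_support (C k)"
    using assms by (simp add: shift_def)
  ultimately have "(C, k) = (shift k C, 0)"
    by blast
  then show ?thesis by simp
qed

lemma assoc_seq_shift: "assoc_seq (shift k C) = shift k (assoc_seq C)"
  by (auto simp: assoc_seq_def shift_def fun_eq_iff algebra_simps)

lemma subwords_shift: "subwords (shift k a) = subwords a"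
proof -
  have *: "subwords (shift k a) \<subseteq> subwords a" for k and a :: "int \<Rightarrow> int"
  proof
    fix w assume "w \<in> subwords (shift k a)"
    then obtain h m where "w = map (\<lambda>j. a ((h + k) + int j)) [1..<Suc m]"
      by (auto simp: subwords_def shift_def algebra_simps)
    then show "w \<in> subwords a"
      unfolding subwords_def by blast
  qed
  have "shift (- k) (shift k a) = a"
    by (simp add: shift_def)
  with *[of k a] *[of "- k" "shift k a"] show ?thesis by auto
qed

lemma E1_shift: "i \<in> E1 (shift k a) \<longleftrightarrow> i + k \<in> E1 a"
proof -
  have E1: "i \<in> E1 a \<longleftrightarrow>
      (\<exists>l. \<forall>j. a (i - 2 * l + 4 * j) = (if even j then a (i - 2 * l) else - a (i - 2 * l)))"
    for i and a :: "int \<Rightarrow> int"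
  proof
    assume "i \<in> E1 a"
    then obtain h l where "i = h + 2 * l"
        "\<forall>k. a (h + 4 * k) = (if even k then a h else - a h)"
      unfolding E1_def by blast
    then show "\<exists>l. \<forall>j. a (i - 2 * l + 4 * j) =
        (if even j then a (i - 2 * l) else - a (i - 2 * l))"
      by (intro exI[of _ l]) simp
  next
    assume "\<exists>l. \<forall>j. a (i - 2 * l + 4 * j) =
        (if even j then a (i - 2 * l) else - a (i - 2 * l))"
    then obtain l where "\<forall>j. a (i - 2 * l + 4 * j) =
        (if even j then a (i - 2 * l) else - a (i - 2 * l))" ..
    then show "i \<in> E1 a"
      unfolding E1_def by (intro CollectI exI[of _ "i - 2 * l"] exI[of _ l]) simp
  qed
  show ?thesis
    unfolding E1 shift_def by (simp add: algebra_simps)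
qed

lemma type_shift:
  "type_H (shift k C) \<longleftrightarrow> type_H C"
  "type_V (shift k C) \<longleftrightarrow> type_V C"
proof -
  have *: "(\<forall>i. P (i + k)) \<longleftrightarrow> (\<forall>i. P i)" for P :: "int \<Rightarrow> bool"
    by (metis diff_add_cancel)
  show "type_H (shift k C) \<longleftrightarrow> type_H C"
    using *[of "\<lambda>i. i \<in> E1 (assoc_seq C) \<longrightarrow> horizontal (C i)"]
    by (simp add: type_H_def assoc_seq_shift Ball_def E1_shift) (simp add: shift_def)
  show "type_V (shift k C) \<longleftrightarrow> type_V C"
    using *[of "\<lambda>i. i \<in> E1 (assoc_seq C) \<longrightarrow> vertical (C i)"]
    by (simp add: type_V_def assoc_seq_shift Ball_def E1_shift) (simp add: shift_def)
qed

lemma decorated_segments_shift: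
  "decorated_segments (insert (shift k C) \<C>) = decorated_segments (insert C \<C>)"
proof -
  have *: "decorated_segments (insert (shift k C) \<C>) \<subseteq> decorated_segments (insert C \<C>)" for k C
  proof
    fix d assume "d \<in> decorated_segments (insert (shift k C) \<C>)"
    then obtain D i where D: "D = shift k C \<or> D \<in> \<C>"
        "d = (D i, seg_support (D (i - 1)), seg_support (D (i + 1)))"
      unfolding decorated_segments_def by blast
    show "d \<in> decorated_segments (insert C \<C>)"
    proof (cases "D \<in> \<C>")
      case True
      with D show ?thesis unfolding decorated_segments_def by blast
    next
      case False
      with D have "d = (C (i + k), seg_support (C (i + k - 1)), seg_support (C (i + k + 1)))"
        by (simp add: shift_def algebra_simps)
      then show ?thesis unfolding decorated_segments_def by blast
    qed
  qed
  have "shift (- k) (shift k C) = C"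
    by (simp add: shift_def)
  with *[of k C] *[of "- k" "shift k C"] show ?thesis by auto
qed

end

theory Submission
  imports Defs
begin

text \<open>
  Every complete folding curve covers all the edges in arbitrarily large disks. Indeed the curve is
  the unfolding of its derived curve, and unfolding a covered disk of radius \<open>R\<close> (measured in half
  edges) yields a covered disk of radius \<open>sqrt 2 * R - 1\<close>; a disk large enough to start this
  recursion appears after unfolding a single edge five times. Hence, by the local isomorphism
  property, every finite pattern of a covering occurs inside any prescribed curve of it, as part of
  an arc. An arc is determined up to translation by its turns and its initial direction. The type
  fixes this direction up to sign, and both signs occur because every subword of a complete folding
  sequence recurs after a half turn.
\<close>

section \<open>Complete folding sequences\<close>

text \<open>The obstacle is that a curve may meet a region along many arcs far apart in its
  parametrization, so a covered disk cannot be read off one short piece of it. Unfolding avoids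
  following the arcs: the finest folds alternate along the curve, and so do the parities of the
  vertices of the derived curve, hence each fold is a function of its place. Membership of an edge
  then depends only on its image under one explicit map of the edge lattice, whatever the order of
  visits. That the type fixes a direction up to sign requires locating \<open>E1\<close> from a
  bounded subword. This works because the letters of the finest fold alternate, while no derived
  sequence contains four consecutive alternating letters, so the two parity classes cannot be
  confused.\<close>

lemma bar_nth: "i < length S \<Longrightarrow> bar S ! i = - S ! (length S - 1 - i)"
  by (simp add: bar_def rev_nth)

lemma length_bar [simp]: "length (bar S) = length S"
  by (simp add: bar_def)

lemma folding_seqs_signs: "S \<in> folding_seqs n \<Longrightarrow> x \<in> set S \<Longrightarrow> x = 1 \<or> x = -1"
proof (induction n arbitrary: S x)
  case (Suc n)
  from Suc.prems(1) obtain S' c where S': "S' \<in> folding_seqs n" "c = 1 \<or> c = -1"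
    and "S = bar S' @ [c] @ S'" by auto
  with Suc.prems(2) have "x = c \<or> x \<in> set S' \<or> - x \<in> set S'"
    by (auto simp: bar_def)
  then show ?case using Suc.IH[OF S'(1)] S'(2) by fastforce
qed simp

text \<open>The recursion adds the coarsest fold, in the middle; this peels off the finest one.
  Since \<open>S\<close> has odd length, reversal preserves the parity of indices and the central
  letter gets an odd index. Alternation crosses the centre because the last letter of
  \<open>bar S\<close> is minus the first letter of \<open>S\<close>.\<close>

lemma folding_seqs_derive:
  "T \<in> folding_seqs (Suc n) \<Longrightarrow>
    (\<forall>k. 2 * k + 2 < length T \<longrightarrow> T ! (2 * k + 2) = - T ! (2 * k)) \<and>
    (\<exists>S \<in> folding_seqs n. length T = 2 * length S + 1 \<and> (\<forall>k < length S. S ! k = T ! (2 * k + 1)))"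
proof (induction n arbitrary: T)
  case 0
  then show ?case by (auto simp: bar_def)
next
  case (Suc n)
  from Suc.prems obtain S c where S: "S \<in> folding_seqs (Suc n)" "c = 1 \<or> c = -1"
    and T: "T = bar S @ [c] @ S"
    by (subst (asm) folding_seqs.simps) auto
  from Suc.IH[OF S(1)] obtain S' where
    alt: "\<And>k. 2 * k + 2 < length S \<Longrightarrow> S ! (2 * k + 2) = - S ! (2 * k)"
    and S': "S' \<in> folding_seqs n" "length S = 2 * length S' + 1"
    "\<And>k. k < length S' \<Longrightarrow> S' ! k = S ! (2 * k + 1)"
    by auto
  define L where "L = length S'"
  have L: "length S = 2 * L + 1" using S' by (simp add: L_def)
  have lo: "T ! i = - S ! (2 * L - i)" if "i \<le> 2 * L" for i
    using that by (simp add: T nth_append bar_nth L)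
  have mid: "T ! (2 * L + 1) = c"
    by (simp add: T nth_append L)
  have hi: "T ! (2 * L + 2 + i) = S ! i" for i
    by (simp add: T nth_append L)
  have "T ! (2 * k + 2) = - T ! (2 * k)" if k: "2 * k + 2 < length T" for k
  proof -
    consider "k < L" | "k = L" | "k > L" by linarith
    then show ?thesis
    proof cases
      case 1
      define j where "j = L - k - 1"
      have "2 * L - (2 * k + 2) = 2 * j" "2 * L - 2 * k = 2 * j + 2"
        using 1 by (auto simp: j_def)
      then show ?thesis
        using 1 alt[of j] lo[of "2 * k"] lo[of "2 * k + 2"] by (simp add: L)
    next
      case 2
      then show ?thesis using lo[of "2 * k"] hi[of 0] by simp
    next
      case 3
      define j where "j = k - L - 1"
      have "2 * k = 2 * L + 2 + 2 * j" using 3 by (simp add: j_def)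
      moreover have "2 * j + 2 < length S" using k 3 by (auto simp: j_def T L)
      ultimately show ?thesis
        using alt[of j] hi[of "2 * j"] hi[of "2 * j + 2"] by (simp add: algebra_simps)
    qed
  qed
  moreover have "bar S' @ [c] @ S' \<in> folding_seqs (Suc n)"
    using S' S by auto
  moreover have "length T = 2 * length (bar S' @ [c] @ S') + 1"
    by (simp add: T S')
  moreover have "(bar S' @ [c] @ S') ! k = T ! (2 * k + 1)" if k: "k < length (bar S' @ [c] @ S')" for k
  proof -
    consider "k < L" | "k = L" | "k > L" by linarith
    then show ?thesis
    proof cases
      case 1
      then have "2 * L - (2 * k + 1) = 2 * (L - 1 - k) + 1" by auto
      then show ?thesis
        using 1 S'(3)[of "L - 1 - k"] lo[of "2 * k + 1"]
        by (simp add: nth_append bar_nth L_def[symmetric])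
    next
      case 2
      then show ?thesis using mid by (simp add: nth_append L_def[symmetric])
    next
      case 3
      define j where "j = k - L - 1"
      have kj: "k = L + 1 + j" using 3 by (simp add: j_def)
      moreover have "j < L" using k 3 by (auto simp: j_def L_def)
      ultimately show ?thesis
        using S'(3)[of j] hi[of "2 * j + 1"]
        by (simp add: nth_append L_def[symmetric] algebra_simps)
    qed
  qed
  ultimately show ?case by blast
qed

section \<open>Windows inside folding words and derived sequences\<close>

text \<open>Unlike \<open>sublist\<close>, this keeps the offset \<open>q\<close>, whose parity
  tells which letters of the window belong to the finest fold.\<close>

definition window_in :: "(int \<Rightarrow> int) \<Rightarrow> int \<Rightarrow> nat \<Rightarrow> int list \<Rightarrow> nat \<Rightarrow> bool" where
  "window_in a h m S q \<longleftrightarrow> q + m \<le> length S \<and> (\<forall>j<m. a (h + int j) = S ! (q + j))"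

lemma window_in_sub:
  assumes "window_in a h m S q" "l + m' \<le> m"
  shows "window_in a (h + int l) m' S (q + l)"
proof -
  have "a (h + int l + int j) = S ! (q + l + j)" if "j < m'" for j
  proof -
    have "l + j < m" using that assms(2) by simp
    then have "a (h + int (l + j)) = S ! (q + (l + j))"
      using assms(1) unfolding window_in_def by blast
    then show ?thesis by (simp add: algebra_simps)
  qed
  then show ?thesis using assms by (simp add: window_in_def)
qed

lemma subwords_eq: "subwords a = {map (\<lambda>j. a (h + int j)) [0..<m] | h m. True}"
proof -
  have *: "map (\<lambda>j. a (h + int j)) [1..<Suc m] = map (\<lambda>j. a (h + 1 + int j)) [0..<m]" for h m
    by (simp add: map_Suc_upt[symmetric] o_def algebra_simps del: upt_Suc)
  show ?thesis
    unfolding subwords_def * by (auto intro: exI[of _ "_ - 1"]) (metis diff_add_cancel)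
qed

lemma complete_folding_seq_iff:
  "complete_folding_seq a \<longleftrightarrow> (\<forall>h m. \<exists>n. \<exists>S \<in> folding_seqs n. \<exists>q. window_in a h m S q)"
proof -
  have *: "sublist (map (\<lambda>j. a (h + int j)) [0..<m]) S \<longleftrightarrow> (\<exists>q. window_in a h m S q)" for h m S
  proof
    assume "sublist (map (\<lambda>j. a (h + int j)) [0..<m]) S"
    then obtain xs ys where "S = xs @ map (\<lambda>j. a (h + int j)) [0..<m] @ ys"
      unfolding sublist_def by blast
    then have "window_in a h m S (length xs)"
      by (simp add: window_in_def nth_append)
    then show "\<exists>q. window_in a h m S q" ..
  next
    assume "\<exists>q. window_in a h m S q"
    then obtain q where q: "q + m \<le> length S" "\<And>j. j < m \<Longrightarrow> a (h + int j) = S ! (q + j)"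
      by (auto simp: window_in_def)
    have "map (\<lambda>j. a (h + int j)) [0..<m] = take m (drop q S)"
      by (rule nth_equalityI) (use q in auto)
    then show "sublist (map (\<lambda>j. a (h + int j)) [0..<m]) S"
      by (metis sublist_order.dual_order.trans sublist_drop sublist_take)
  qed
  show ?thesis
    unfolding complete_folding_seq_def subwords_eq
    by (auto simp: *) (metis *)+
qed

lemma complete_folding_seq_sign:
  assumes "complete_folding_seq a"
  shows "a i = 1 \<or> a i = -1"
proof -
  obtain n S q where "S \<in> folding_seqs n" "window_in a i 1 S q"
    using assms complete_folding_seq_iff by blast
  then show ?thesis
    using folding_seqs_signs[of S n "S ! q"] by (auto simp: window_in_def)
qed

text \<open>A relation rather than a function: \<open>p\<close> is any position of the finest fold,
  and moving it by an even number merely reindexes \<open>b\<close>.\<close>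

definition derived :: "(int \<Rightarrow> int) \<Rightarrow> int \<Rightarrow> (int \<Rightarrow> int) \<Rightarrow> bool" where
  "derived a p b \<longleftrightarrow> (\<forall>k. a (p + 2 * k + 2) = - a (p + 2 * k)) \<and>
     (\<forall>k. b k = a (p + 2 * k + 1)) \<and> complete_folding_seq b"

text \<open>
  Every finite window sits in a folding sequence at an even or at an odd offset; by pigeonhole
  one of the two parities works for all windows at once.
\<close>
lemma complete_folding_seq_derived:
  assumes a: "complete_folding_seq a"
  obtains p b where "derived a p b"
proof -
  \<comment> \<open>Position \<open>x\<close> of \<open>a\<close> has index \<open>q + N + x\<close>
    in \<open>S\<close>, so the parity condition says that the class of \<open>p\<close> falls on
    the even indices.\<close>
  define good where "good p N \<longleftrightarrow> (\<exists>n. \<exists>S \<in> folding_seqs (Suc n). \<exists>q.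
      window_in a (- int N) (2 * N + 1) S q \<and> even (int q + int N + p))" for p :: int and N :: nat
  have sub: "good p N" if "good p N'" "N \<le> N'" for p N N'
  proof -
    from that(1) obtain n S q where S: "S \<in> folding_seqs (Suc n)"
      "window_in a (- int N') (2 * N' + 1) S q" "even (int q + int N' + p)"
      unfolding good_def by blast
    have "window_in a (- int N' + int (N' - N)) (2 * N + 1) S (q + (N' - N))"
      by (rule window_in_sub[OF S(2)]) (use that in simp)
    moreover have "- int N' + int (N' - N) = - int N" using that by simp
    moreover have "int (q + (N' - N)) + int N + p = int q + int N' + p"
      using that by simp
    ultimately show ?thesis
      unfolding good_def using S(1,3) by metis
  qed
  have "good 0 N \<or> good 1 N" for N
  proof -
    obtain n S q where S: "S \<in> folding_seqs n" "window_in a (- int N) (2 * N + 1) S q"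
      using a complete_folding_seq_iff by blast
    then obtain n' where "n = Suc n'" by (cases n) (auto simp: window_in_def)
    with S show ?thesis unfolding good_def
      by (cases "even (int q + int N)") (auto simp del: folding_seqs.simps)
  qed
  then obtain p where "infinite {N. good p N}"
  proof -
    have "UNIV = {N. good 0 N} \<union> {N. good 1 N}"
      using \<open>\<And>N. good 0 N \<or> good 1 N\<close> by blast
    then have "infinite {N. good 0 N} \<or> infinite {N. good 1 N}"
      by (metis finite_Un infinite_UNIV_nat)
    then show ?thesis using that by blast
  qed
  then have good: "good p N" for N
    by (metis infinite_nat_iff_unbounded_le mem_Collect_eq sub)
  have window: "\<exists>n. \<exists>S \<in> folding_seqs (Suc n). \<exists>q. window_in a (p + 2 * k) m S (2 * q)" for k m
  proof -
    define N where "N = nat \<bar>p + 2 * k\<bar> + m"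
    obtain n S q where S: "S \<in> folding_seqs (Suc n)"
      "window_in a (- int N) (2 * N + 1) S q" "even (int q + int N + p)"
      using good unfolding good_def by blast
    define l where "l = nat (p + 2 * k + int N)"
    have l: "int l = p + 2 * k + int N" by (simp add: l_def N_def)
    have "l + m \<le> 2 * N + 1" using l by (auto simp: N_def)
    from window_in_sub[OF S(2) this] have "window_in a (p + 2 * k) m S (q + l)"
      by (simp add: l)
    moreover have "even (q + l)"
    proof -
      have "int (q + l) = int q + int N + p + 2 * k" by (simp add: l)
      then show ?thesis using S(3) by (metis dvd_add dvd_triv_left even_of_nat)
    qed
    ultimately show ?thesis using S(1) by (metis evenE)
  qed
  have "a (p + 2 * k + 2) = - a (p + 2 * k)" for k
  proof -
    obtain n S q where S: "S \<in> folding_seqs (Suc n)" "window_in a (p + 2 * k) 3 S (2 * q)"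
      using window by blast
    then have "a (p + 2 * k + int 2) = S ! (2 * q + 2)" "a (p + 2 * k + int 0) = S ! (2 * q + 0)"
      "2 * q + 2 < length S"
      unfolding window_in_def by (simp_all only: ) auto
    then show ?thesis using folding_seqs_derive[OF S(1)] by auto
  qed
  moreover have "complete_folding_seq (\<lambda>k. a (p + 2 * k + 1))"
    unfolding complete_folding_seq_iff
  proof (intro allI)
    fix h m
    obtain n S q where S: "S \<in> folding_seqs (Suc n)" "window_in a (p + 2 * h) (2 * m + 1) S (2 * q)"
      using window by blast
    obtain S' where S': "S' \<in> folding_seqs n" "length S = 2 * length S' + 1"
      "\<And>k. k < length S' \<Longrightarrow> S' ! k = S ! (2 * k + 1)"
      using folding_seqs_derive[OF S(1)] by auto
    have "a (p + 2 * (h + int j) + 1) = S' ! (q + j)" if "j < m" for j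
    proof -
      have "a (p + 2 * h + int (2 * j + 1)) = S ! (2 * q + (2 * j + 1))"
        using S(2) that unfolding window_in_def by (metis Suc_eq_plus1 Suc_less_eq nat_mult_less_cancel1 zero_less_numeral)
      moreover have "q + j < length S'" using S(2) S'(2) that by (auto simp: window_in_def)
      ultimately show ?thesis using S'(3)[of "q + j"] by (simp add: algebra_simps)
    qed
    moreover have "q + m \<le> length S'" using S(2) S'(2) by (auto simp: window_in_def)
    ultimately show "\<exists>n. \<exists>S \<in> folding_seqs n. \<exists>q. window_in (\<lambda>k. a (p + 2 * k + 1)) h m S q"
      using S'(1) unfolding window_in_def by blast
  qed
  ultimately show ?thesis
    using that[of p "\<lambda>k. a (p + 2 * k + 1)"] by (simp add: derived_def)
qed

lemma derived_alt:
  assumes "derived a p b"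
  shows "a (p + 2 * k) = (if even k then a p else - a p)"
proof (induction k rule: int_induct[where k = 0])
  case base
  then show ?case by simp
next
  case (step1 i)
  then show ?case using assms by (auto simp: derived_def algebra_simps)
next
  case (step2 i)
  have "a (p + 2 * (i - 1) + 2) = - a (p + 2 * (i - 1))"
    using assms unfolding derived_def by blast
  then show ?case using step2 by (auto simp: algebra_simps)
qed

lemma derived_shift2:
  assumes "derived a p b" "even (i - p)"
  shows "a (i + 2) = - a i"
proof -
  obtain k where "i = p + 2 * k" using assms(2) by (metis evenE add.commute diff_add_cancel)
  then show ?thesis using assms(1) by (simp add: derived_def)
qed

lemma derived_nth:
  assumes "derived a p b"
  shows "a (p + 2 * k + 1) = b k"
  using assms by (simp add: derived_def)

text \<open>Four consecutive letters contain two at distance 2 from the finest fold, which are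
  opposite; full alternation would make them equal.\<close>

lemma not_alternating:
  assumes "complete_folding_seq b"
  shows "\<not> (b (h + 1) = - b h \<and> b (h + 2) = - b (h + 1) \<and> b (h + 3) = - b (h + 2))"
proof -
  obtain p c where d: "derived b p c" using complete_folding_seq_derived[OF assms] .
  have "b (h + 2) = - b h \<or> b (h + 3) = - b (h + 1)"
    using derived_shift2[OF d, of h] derived_shift2[OF d, of "h + 1"] by (auto simp: algebra_simps)
  then show ?thesis
    using complete_folding_seq_sign[OF assms, of h] complete_folding_seq_sign[OF assms, of "h + 1"]
    by auto
qed

text \<open>If the parities disagreed, the letters at offsets 0, 2, 4, 6 would alternate on one side
  and be four consecutive letters of a derived sequence on the other.\<close>

lemma derived_parity_unique:
  assumes a: "derived a p b" and a': "derived a' p' b'"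
    and eq: "\<And>j. j < 8 \<Longrightarrow> a (i + int j) = a' (i' + int j)"
  shows "even (i - p) \<longleftrightarrow> even (i' - p')"
proof -
  have *: False if a: "derived a p b" and a': "derived a' p' b'"
    and eq: "\<And>j. j < 8 \<Longrightarrow> a (i + int j) = a' (i' + int j)"
    and e: "even (i - p)" and o: "odd (i' - p')" for a p b a' p' b' and i i' :: int
  proof -
    obtain k where k: "i' = p' + 2 * k + 1" using o by (metis add.commute diff_add_cancel oddE add.assoc)
    have alt: "a (i + 2) = - a i" "a (i + 4) = - a (i + 2)" "a (i + 6) = - a (i + 4)"
      using derived_shift2[OF a, of i] derived_shift2[OF a, of "i + 2"]
        derived_shift2[OF a, of "i + 4"] e by (auto simp: add.commute)
    have "b' k = a i" "b' (k + 1) = a (i + 2)" "b' (k + 2) = a (i + 4)" "b' (k + 3) = a (i + 6)"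
      using eq[of 0] eq[of 2] eq[of 4] eq[of 6]
      by (simp_all add: k derived_nth[OF a', symmetric] algebra_simps)
    then show False
      using not_alternating[of b' k] a' alt by (simp add: derived_def)
  qed
  show ?thesis
    using *[OF a a' eq] *[OF a' a eq[symmetric]] by blast
qed

text \<open>The finest fold has period 4, which excludes its class from \<open>E1\<close>. In the
  other class, the finest fold of \<open>b\<close> supplies letters of \<open>a\<close> at distance
  4 that alternate.\<close>

lemma E1_derived:
  assumes a: "derived a p b" and sgn: "\<And>i. a i = 1 \<or> a i = -1"
  shows "E1 a = {i. odd (i - p)}"
proof (rule set_eqI)
  fix i
  have "odd (h - p)" if h: "\<forall>k. a (h + 4 * k) = (if even k then a h else - a h)" for h
  proof
    assume "even (h - p)"
    then have "a (h + 4) = a h"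
      using derived_shift2[OF a, of h] derived_shift2[OF a, of "h + 2"] by (simp add: add.commute)
    moreover have "a (h + 4 * 1) = - a h" using h by (metis odd_one)
    ultimately show False using sgn[of h] by auto
  qed
  then have "odd (i - p)" if "i \<in> E1 a"
  proof -
    from that obtain h l where "i = h + 2 * l"
      "\<forall>k. a (h + 4 * k) = (if even k then a h else - a h)" unfolding E1_def by blast
    then show ?thesis using \<open>\<And>h. _ \<Longrightarrow> odd (h - p)\<close>[of h] by simp
  qed
  moreover have "i \<in> E1 a" if "odd (i - p)"
  proof -
    obtain q c where c: "derived b q c"
      using a complete_folding_seq_derived unfolding derived_def by blast
    define h where "h = p + 2 * q + 1"
    have "a (h + 4 * k) = (if even k then a h else - a h)" for k
      using derived_alt[OF c, of k] derived_nth[OF a, of "q + 2 * k"] derived_nth[OF a, of q]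
      by (simp add: h_def algebra_simps)
    moreover have "even (i - h)" using that by (simp add: h_def)
    then obtain l where "i = h + 2 * l" by (metis evenE add.commute diff_add_cancel)
    ultimately show ?thesis unfolding E1_def by blast
  qed
  ultimately show "i \<in> E1 a \<longleftrightarrow> i \<in> {i. odd (i - p)}" by blast
qed

section \<open>Recurrence of subwords after a half turn\<close>

text \<open>
  The direction of a curve is multiplied by \<open>- a i * a (i + 1)\<close> over two consecutive turns, so
  this is the sign by which \<open>2 * n\<close> turns starting with \<open>a i\<close> multiply the direction.
\<close>
definition turn_sign :: "(int \<Rightarrow> int) \<Rightarrow> int \<Rightarrow> nat \<Rightarrow> int" where
  "turn_sign a i n = (\<Prod>j<n. - a (i + 2 * int j) * a (i + 2 * int j + 1))"

lemma turn_sign_0 [simp]: "turn_sign a i 0 = 1"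
  by (simp add: turn_sign_def)

lemma turn_sign_Suc:
  "turn_sign a i (Suc n) = turn_sign a i n * (- a (i + 2 * int n) * a (i + 2 * int n + 1))"
  by (simp add: turn_sign_def)

lemma turn_sign_cases:
  assumes "\<And>i. a i = 1 \<or> a i = -1"
  shows "turn_sign a i n = 1 \<or> turn_sign a i n = -1"
proof (induction n)
  case (Suc n)
  then show ?case
    using assms[of "i + 2 * int n"] assms[of "i + 2 * int n + 1"] by (auto simp: turn_sign_Suc)
qed simp

text \<open>Of any four consecutive letters of \<open>a\<close>, two belong to the finest fold and
  have product -1; the other two are consecutive letters of \<open>b\<close>. Hence two pairs of
  \<open>a\<close> contribute the same sign as one pair of \<open>b\<close>.\<close>

lemma turn_sign_derived:
  assumes a: "derived a p b" and sgn: "\<And>i. a i = 1 \<or> a i = -1" and k: "k = (i - p) div 2"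
  shows "turn_sign a i (2 * n) = turn_sign b k n"
proof (induction n)
  case (Suc n)
  let ?i = "i + 4 * int n"
  have "a ?i * a (?i + 1) * (a (?i + 2) * a (?i + 3)) = - b (k + 2 * int n) * b (k + 2 * int n + 1)"
  proof (cases "even (i - p)")
    case True
    then have i: "i = p + 2 * k" by (simp add: k)
    have "a (?i + 1) = b (k + 2 * int n)" "a (?i + 3) = b (k + 2 * int n + 1)"
      by (simp_all add: derived_nth[OF a, symmetric] i algebra_simps)
    moreover have "a (?i + 2) = - a ?i" using derived_shift2[OF a, of ?i] True by simp
    ultimately show ?thesis using sgn[of ?i] by auto
  next
    case False
    then have i: "i = p + 2 * k + 1" using k by presburger
    have "a ?i = b (k + 2 * int n)" "a (?i + 2) = b (k + 2 * int n + 1)"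
      by (simp_all add: derived_nth[OF a, symmetric] i algebra_simps)
    moreover have "a (?i + 3) = - a (?i + 1)"
      using derived_shift2[OF a, of "?i + 1"] False by (simp add: algebra_simps)
    ultimately show ?thesis using sgn[of "?i + 1"] by auto
  qed
  then show ?case
    using Suc by (simp add: turn_sign_Suc algebra_simps)
qed simp

text \<open>If every aligned pair were opposite, the alternation of the finest fold of
  \<open>b\<close> would pass to the neighbouring letters, which form \<open>c\<close>, against
  \<open>not_alternating\<close>.\<close>

lemma equal_pair_exists:
  assumes "complete_folding_seq b"
  obtains j :: nat where "b (k + 2 * int j + 1) = b (k + 2 * int j)"
proof (rule ccontr)
  assume "\<not> thesis"
  with that have "b (k + 2 * int j + 1) \<noteq> b (k + 2 * int j)" for j by blast
  then have *: "b (k + 2 * int j + 1) = - b (k + 2 * int j)" for j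
    using complete_folding_seq_sign[OF assms] by (metis minus_equation_iff)
  obtain p c where d: "derived b p c" using complete_folding_seq_derived[OF assms] .
  show False
  proof (cases "even (k - p)")
    case True
    then obtain l where l: "k = p + 2 * l" by (metis evenE add.commute diff_add_cancel)
    have "c (l + int j) = - b (k + 2 * int j)" for j
      using *[of j] by (simp add: derived_nth[OF d, symmetric] l algebra_simps)
    moreover have "b (k + 2 * int (Suc j)) = - b (k + 2 * int j)" for j
      using derived_shift2[OF d, of "k + 2 * int j"] True by (simp add: algebra_simps)
    ultimately have "c (l + int (Suc j)) = - c (l + int j)" for j by metis
    from this[of 0] this[of 1] this[of 2] show False
      using not_alternating[of c l] d by (simp add: derived_def algebra_simps)
  next
    case False
    then obtain l where l: "k = p + 2 * l + 1" by (metis add.commute diff_add_cancel oddE add.assoc)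
    have "c (l + int j) = - b (k + 2 * int j + 1)" for j
      using *[of j] by (simp add: derived_nth[OF d, symmetric] l algebra_simps)
    moreover have "b (k + 2 * int (Suc j) + 1) = - b (k + 2 * int j + 1)" for j
      using derived_shift2[OF d, of "k + 2 * int j + 1"] False by (simp add: algebra_simps)
    ultimately have "c (l + int (Suc j)) = - c (l + int j)" for j by metis
    from this[of 0] this[of 1] this[of 2] show False
      using not_alternating[of c l] d by (simp add: derived_def algebra_simps)
  qed
qed

text \<open>An equal pair contributes the factor -1, so the signs just before and just after it
  differ.\<close>

lemma turn_sign_neg_exists:
  assumes "complete_folding_seq b"
  obtains n where "turn_sign b k n = -1"
proof (rule ccontr)
  assume "\<not> thesis"
  then have 1: "turn_sign b k n = 1" for n
    using that turn_sign_cases complete_folding_seq_sign[OF assms] by metis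
  obtain j :: nat where "b (k + 2 * int j + 1) = b (k + 2 * int j)"
    using equal_pair_exists[OF assms] .
  then show False
    using 1[of "Suc j"] 1[of j] complete_folding_seq_sign[OF assms, of "k + 2 * int j"]
    by (auto simp: turn_sign_Suc)
qed

lemma derived_shift4:
  assumes "derived a p b" "even (i - p)"
  shows "a (i + 4 * int n) = a i"
proof (induction n)
  case (Suc n)
  then show ?case
    using derived_shift2[OF assms(1), of "i + 4 * int n"]
      derived_shift2[OF assms(1), of "i + 4 * int n + 2"] assms(2) by (simp add: algebra_simps)
qed simp

text \<open>A letter of the finest fold recurs with period 4, so any even number of pairs preserves
  it, and the sign can be chosen in \<open>b\<close>.\<close>

lemma half_turn_letter_nonderived:
  assumes a: "derived a p b" and sgn: "\<And>i. a i = 1 \<or> a i = -1" and i: "even (i - p)"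
  shows "\<exists>n. a (i + 2 * int n) = a i \<and> turn_sign a i n = -1"
proof -
  obtain n where "turn_sign b ((i - p) div 2) n = -1"
    using turn_sign_neg_exists a unfolding derived_def by blast
  then have "turn_sign a i (2 * n) = -1" using turn_sign_derived[OF a sgn] by simp
  moreover have "a (i + 2 * int (2 * n)) = a i"
    using derived_shift4[OF a i, of n] by simp
  ultimately show ?thesis by blast
qed

text \<open>
  If the position survives two derivations, the shifts considered are by \<open>2 * (2 * l + 1)\<close> with
  \<open>l\<close> in a fixed residue class mod 2; the sign cannot be constant along them, as this would
  contradict \<open>equal_pair_exists\<close> for the second derived sequence.
\<close>
lemma half_turn_letter:
  assumes a: "complete_folding_seq a"
  shows "\<exists>n. a (i + 2 * int n) = a i \<and> turn_sign a i n = -1"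
proof -
  note sgn = complete_folding_seq_sign[OF a]
  obtain p b where b: "derived a p b" using complete_folding_seq_derived[OF a] .
  then have bf: "complete_folding_seq b" by (simp add: derived_def)
  note sgnb = complete_folding_seq_sign[OF bf]
  obtain q c where c: "derived b q c" using complete_folding_seq_derived[OF bf] .
  then have cf: "complete_folding_seq c" by (simp add: derived_def)
  note sgnc = complete_folding_seq_sign[OF cf]
  show ?thesis
  proof (cases "even (i - p)")
    case True
    then show ?thesis using half_turn_letter_nonderived[OF b sgn] by simp
  next
    case False
    then obtain k where k: "i = p + 2 * k + 1" by (metis add.commute diff_add_cancel oddE add.assoc)
    have ab: "a (i + 2 * int n) = b (k + int n)" for n
      by (simp add: derived_nth[OF b, symmetric] k algebra_simps)
    have kd: "(i - p) div 2 = k" by (simp add: k)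
    show ?thesis
    proof (cases "even (k - q)")
      case True
      then obtain n where n: "b (k + 2 * int n) = b k" "turn_sign b k n = -1"
        using half_turn_letter_nonderived[OF c sgnb] by blast
      have "turn_sign a i (2 * n) = -1" using turn_sign_derived[OF b sgn, of k i n] kd n by simp
      moreover have "a (i + 2 * int (2 * n)) = a i" using n ab[of "2 * n"] ab[of 0] by simp
      ultimately show ?thesis by blast
    next
      case False
      then obtain r where r: "k = q + 2 * r + 1" by (metis add.commute diff_add_cancel oddE add.assoc)
      have bc: "b (k + 2 * int l) = c (r + int l)" for l
        by (simp add: derived_nth[OF c, symmetric] r algebra_simps)
      have alt: "b (k + 2 * int l + 3) = - b (k + 2 * int l + 1)" for l
        using derived_shift2[OF c, of "k + 2 * int l + 1"] False by (simp add: algebra_simps)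
      have per: "a (i + 1 + 4 * int l) = a (i + 1)" for l
        using derived_shift4[OF b, of "i + 1"] k by simp
      \<comment> \<open>The finest fold of \<open>b\<close> takes both signs at \<open>k + 1\<close>
        and \<open>k + 3\<close>; this picks the place where it agrees with \<open>b k\<close>, and
        period 4 then gives the family \<open>L\<close>.\<close>
      obtain l0 :: nat where l0: "b (k + 2 * int l0 + 1) = b k"
      proof -
        have "b (k + 2 * int 0 + 1) = b k \<or> b (k + 2 * int 1 + 1) = b k"
          using alt[of 0] sgnb[of k] sgnb[of "k + 1"] by (auto simp: add.commute)
        then show ?thesis using that by blast
      qed
      define L where "L j = l0 + 2 * j" for j
      have Lb: "b (k + 2 * int (L j) + 1) = b k" for j
      proof (induction j)
        case 0
        then show ?case using l0 by (simp add: L_def)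
      next
        case (Suc j)
        then show ?case using alt[of "L j"] alt[of "L j + 1"] by (simp add: L_def algebra_simps)
      qed
      define G where "G j = turn_sign a i (2 * L j + 1)" for j
      have G: "G j = - turn_sign b k (L j) * c (r + int (L j)) * a (i + 1)" for j
        using turn_sign_derived[OF b sgn, of k i "L j"] kd ab[of "2 * L j"] bc[of "L j"] per[of "L j"]
        by (simp add: G_def turn_sign_Suc algebra_simps)
      show ?thesis
      proof (rule ccontr)
        assume none: "\<not> ?thesis"
        have "a (i + 2 * int (2 * L j + 1)) = a i" for j
          using ab[of "2 * L j + 1"] ab[of 0] Lb[of j] by (simp add: algebra_simps)
        then have "G j \<noteq> -1" for j using none unfolding G_def by blast
        then have G1: "G j = 1" for j
          using turn_sign_cases[of a i "2 * L j + 1", OF sgn] unfolding G_def by blast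
        \<comment> \<open>Passing from \<open>G j\<close> to \<open>G (Suc j)\<close> multiplies by
          \<open>- c (r + L j + 1) * c (r + L j + 2)\<close>, so an equal pair at exactly this place
          flips the sign.\<close>
        obtain j :: nat where "c ((r + int l0 + 1) + 2 * int j + 1) = c ((r + int l0 + 1) + 2 * int j)"
          using equal_pair_exists[OF cf] .
        then have j: "c (r + int (L j) + 2) = c (r + int (L j) + 1)"
          by (simp add: L_def algebra_simps)
        have "turn_sign b k (L (Suc j)) = turn_sign b k (L j) *
            (- c (r + int (L j)) * b (k + 2 * int (L j) + 1)) *
            (- c (r + int (L j) + 1) * b (k + 2 * int (L j) + 3))"
          using bc[of "L j"] bc[of "L j + 1"]
          by (simp add: L_def turn_sign_Suc algebra_simps)
        also have "\<dots> = - turn_sign b k (L j) * c (r + int (L j)) * c (r + int (L j) + 1)"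
          using alt[of "L j"] Lb[of j] sgnb[of k] by auto
        finally have "G (Suc j) = turn_sign b k (L j) * c (r + int (L j)) * c (r + int (L j) + 1)
            * c (r + int (L j) + 1) * a (i + 1)"
          using j unfolding G[of "Suc j"] by (simp add: L_def algebra_simps)
        also have "\<dots> = - G j"
          unfolding G using sgnc[of "r + int (L j) + 1"] by auto
        finally show False using G1 by (metis neg_equal_zero one_neq_zero)
      qed
    qed
  qed
qed

text \<open>Letters of the finest fold return under shifts by multiples of 4, so only the derived
  letters constrain the shift, and at most \<open>(m + 1) div 2\<close> of them lie in the window.
  For \<open>m = 1\<close> this number does not decrease, which is why a single letter needs its own
  argument.\<close>

lemma half_turn_window:
  assumes "complete_folding_seq a"
  shows "\<exists>n. (\<forall>j<m. a (i + int j + 2 * int n) = a (i + int j)) \<and> turn_sign a i n = -1"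
  using assms
proof (induction m arbitrary: a i rule: less_induct)
  case (less m)
  note a = less.prems
  show ?case
  proof (cases "m \<le> 1")
    case True
    then show ?thesis using half_turn_letter[OF a, of i] by (auto simp: less_Suc_eq le_Suc_eq)
  next
    case False
    obtain p b where b: "derived a p b" using complete_folding_seq_derived[OF a] .
    then have bf: "complete_folding_seq b" by (simp add: derived_def)
    define k where "k = (i - p) div 2"
    define m' where "m' = (m + 1) div 2"
    have "m' < m" using False by (simp add: m'_def)
    from less.IH[OF this bf, of k] obtain n where
      n: "\<And>j. j < m' \<Longrightarrow> b (k + int j + 2 * int n) = b (k + int j)" "turn_sign b k n = -1" by blast
    have "turn_sign a i (2 * n) = -1"
      using turn_sign_derived[OF b complete_folding_seq_sign[OF a] k_def] n by simp
    moreover have "a (i + int j + 2 * int (2 * n)) = a (i + int j)" if "j < m" for j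
    proof (cases "even (i + int j - p)")
      case True
      then show ?thesis using derived_shift4[OF b, of "i + int j" n] by simp
    next
      case False
      then obtain K where "i + int j - p = 2 * K + 1" by (elim oddE)
      then have K: "i + int j = p + 2 * K + 1" by linarith
      have k: "i - p = 2 * k \<or> i - p = 2 * k + 1" unfolding k_def by presburger
      define l where "l = nat (K - k)"
      have "K - k \<ge> 0" using K k by linarith
      then have l': "int l = K - k" by (simp add: l_def)
      then have "2 * int l < int m" using K k that by linarith
      then have "l < m'" unfolding m'_def by linarith
      moreover have l: "i + int j = p + 2 * (k + int l) + 1" using K l' by simp
      ultimately have "b (k + int l + 2 * int n) = b (k + int l)" using n(1) by simp
      then show ?thesis
        using derived_nth[OF b, of "k + int l"] derived_nth[OF b, of "k + int l + 2 * int n"]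
        unfolding l by (simp add: algebra_simps)
    qed
    ultimately show ?thesis by blast
  qed
qed

section \<open>Unfolding and covered disks\<close>

definition turn :: "int \<Rightarrow> point \<Rightarrow> point" where
  "turn s d = (- s * snd d, s * fst d)"

definition unit_vectors :: "point set" where
  "unit_vectors = {(1, 0), (-1, 0), (0, 1), (0, -1)}"

text \<open>Only vertices and turns are kept, and self-avoidance is left out, so that the derived
  walk belongs to the same class without further proof.\<close>

definition folding_walk :: "(int \<Rightarrow> point) \<Rightarrow> (int \<Rightarrow> int) \<Rightarrow> bool" where
  "folding_walk P a \<longleftrightarrow> complete_folding_seq a \<and>
     (\<forall>i. P (i + 1) - P i \<in> unit_vectors \<and> P (i + 2) - P (i + 1) = turn (a i) (P (i + 1) - P i))"

definition odd_point :: "point \<Rightarrow> bool" where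
  "odd_point e \<longleftrightarrow> odd (fst e + snd e)"

text \<open>
  A unit edge is encoded by the sum of its endpoints, that is, twice its midpoint. This identifies
  the unit edges with the lattice points whose coordinate sum is odd.
\<close>
definition edge_sums :: "(int \<Rightarrow> point) \<Rightarrow> point set" where
  "edge_sums P = range (\<lambda>i. P i + P (i + 1))"

text \<open>Multiplication by \<open>1 + i\<close> in the Gaussian integers; \<open>undil\<close> is
  division by \<open>1 + i\<close>, exact on points of even coordinate sum.\<close>

definition dil :: "point \<Rightarrow> point" where
  "dil z = (fst z - snd z, fst z + snd z)"

definition undil :: "point \<Rightarrow> point" where
  "undil z = ((fst z + snd z) div 2, (snd z - fst z) div 2)"

text \<open>The nontrivial character modulo 4 on odd integers. \<open>offset\<close> applies it to
  the odd coordinate of an odd point; the value at even integers is a default.\<close>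

definition sgn4 :: "int \<Rightarrow> int" where
  "sgn4 x = (if x mod 4 = 1 then 1 else -1)"

text \<open>
  Unfolding replaces an edge \<open>m\<close> of the derived curve by the two legs of a right isosceles triangle
  erected on \<open>dil m\<close>. Since the folds alternate, the side of the triangle depends only on the
  position of the edge, up to a global sign \<open>s\<close>; \<open>contract s e\<close> is the edge that \<open>e\<close> comes from.
\<close>
definition offset :: "int \<Rightarrow> point \<Rightarrow> point" where
  "offset s e = (if even (fst e) then (s * sgn4 (snd e), 0) else (0, - s * sgn4 (fst e)))"

definition contract :: "int \<Rightarrow> point \<Rightarrow> point" where
  "contract s e = undil (e - offset s e)"

lemma sgn4_cases: "sgn4 x = 1 \<or> sgn4 x = -1"
  by (simp add: sgn4_def)

lemma dil_undil: "even (fst z + snd z) \<Longrightarrow> dil (undil z) = z"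
  by (cases z) (auto simp: dil_def undil_def elim!: evenE, presburger+)

lemma dil_inj: "dil z = dil w \<Longrightarrow> z = w"
  by (cases z; cases w) (auto simp: dil_def)

lemma dil_add: "dil (z + w) = dil z + dil w"
  by (simp add: dil_def)

lemma dil_diff: "dil (z - w) = dil z - dil w"
  by (simp add: dil_def)

lemma dil_contract:
  assumes "odd_point e" "s = 1 \<or> s = -1"
  shows "dil (contract s e) = e - offset s e"
  unfolding contract_def
  by (rule dil_undil)
    (use assms sgn4_cases[of "fst e"] sgn4_cases[of "snd e"] in \<open>auto simp: odd_point_def offset_def\<close>)

lemma odd_point_contract:
  assumes "odd_point e" "s = 1 \<or> s = -1"
  shows "odd_point (contract s e)"
proof -
  have "fst (contract s e) + snd (contract s e) = snd (dil (contract s e))"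
    by (simp add: dil_def)
  also have "\<dots> = snd (e - offset s e)"
    using dil_contract[OF assms] by simp
  also have "odd \<dots>"
    using assms sgn4_cases[of "fst e"] by (auto simp: odd_point_def offset_def)
  finally show ?thesis by (simp add: odd_point_def)
qed

text \<open>This moves the translations arising at successive levels past the contractions. Shifting
  by twice \<open>dil t\<close> changes the odd coordinate by twice a number with the parity of
  \<open>fst t + snd t\<close>, so an odd \<open>t\<close> flips \<open>sgn4\<close>, hence the
  sign.\<close>

lemma contract_translate:
  assumes "odd_point e" "s = 1 \<or> s = -1"
    and s': "s' = (if even (fst t + snd t) then s else - s)"
  shows "contract s (e + (dil t + dil t)) = contract s' e + (t + t)"
proof (rule dil_inj)
  have flip: "sgn4 (x + 2 * y) = (if even y then sgn4 x else - sgn4 x)" if "odd x" for x y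
  proof (cases "even y")
    case True
    then obtain k where "y = 2 * k" by (elim evenE)
    then show ?thesis by (simp add: sgn4_def)
  next
    case False
    then obtain k where "y = 2 * k + 1" by (elim oddE)
    then show ?thesis using that by (simp add: sgn4_def) presburger
  qed
  have *: "offset s (e + (dil t + dil t)) = offset s' e"
  proof -
    have "sgn4 (snd e + (fst t + snd t + (fst t + snd t))) =
        (if even (fst t + snd t) then sgn4 (snd e) else - sgn4 (snd e))" if "odd (snd e)"
      using flip[OF that, of "fst t + snd t"] by (simp add: algebra_simps)
    moreover have "sgn4 (fst e + (fst t - snd t + (fst t - snd t))) =
        (if even (fst t + snd t) then sgn4 (fst e) else - sgn4 (fst e))" if "odd (fst e)"
      using flip[OF that, of "fst t - snd t"] by (simp add: algebra_simps)
    ultimately show ?thesis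
      using assms(1) by (auto simp: offset_def dil_def s' odd_point_def)
  qed
  have "odd_point (e + (dil t + dil t))"
    using assms(1) by (simp add: odd_point_def dil_def)
  moreover have "s' = 1 \<or> s' = -1" using assms by auto
  ultimately show "dil (contract s (e + (dil t + dil t))) = dil (contract s' e + (t + t))"
    using assms by (simp add: dil_contract * dil_add algebra_simps)
qed

text \<open>Here \<open>z\<close> is a dilated vertex of the derived walk and \<open>d\<close>,
  \<open>turn \<eta> d\<close> are the two legs erected on its next edge. The equation says that
  \<open>e\<close> contracts to that edge; the conclusion lists the doubled midpoints of the two
  legs.\<close>

lemma offset_cases:
  assumes d: "d \<in> unit_vectors" and xy: "even (fst z + snd z)" and s: "s = 1 \<or> s = -1"
    and e: "odd_point e" and eq: "e - offset s e = z + z + d + turn \<eta> d"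
    and \<eta>: "\<eta> = (if even (fst z) then s else - s)"
  shows "e = z + z + d \<or> e = z + z + d + d + turn \<eta> d"
proof -
  have sgn4: "sgn4 (2 * x + D) = (if even x then D else - D)" if "D = 1 \<or> D = -1" for x D
    using that by (auto simp: sgn4_def elim!: evenE oddE) presburger+
  obtain x y where z: "z = (x, y)" by (cases z)
  obtain u v where euv: "e = (u, v)" by (cases e)
  have xy': "even y \<longleftrightarrow> even x" using xy z by simp
  define D1 D2 where "D1 = fst (d + turn \<eta> d)" and "D2 = snd (d + turn \<eta> d)"
  have \<eta>1: "\<eta> = 1 \<or> \<eta> = -1" using \<eta> s by auto
  then have D: "D1 = 1 \<or> D1 = -1" "D2 = 1 \<or> D2 = -1"
    using d by (auto simp: D1_def D2_def unit_vectors_def turn_def)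
  show ?thesis
  proof (cases "even u")
    case True
    then have v: "v = 2 * y + D2" and "u = 2 * x + D1 + s * sgn4 v"
      using eq by (auto simp: z euv offset_def D1_def D2_def prod_eq_iff)
    then have "u = 2 * x + D1 + \<eta> * D2"
      unfolding v sgn4[OF D(2)] using xy' \<eta> z by auto
    then show ?thesis
      using d \<eta>1 v by (auto simp: z euv D1_def D2_def unit_vectors_def turn_def)
  next
    case False
    then have u: "u = 2 * x + D1" and "v = 2 * y + D2 - s * sgn4 u"
      using eq by (auto simp: z euv offset_def D1_def D2_def prod_eq_iff)
    then have "v = 2 * y + D2 - \<eta> * D1"
      unfolding u sgn4[OF D(1)] using xy' \<eta> z by auto
    then show ?thesis
      using d \<eta>1 u by (auto simp: z euv D1_def D2_def unit_vectors_def turn_def)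
  qed
qed

lemma turn_unit: "d \<in> unit_vectors \<Longrightarrow> s = 1 \<or> s = -1 \<Longrightarrow> turn s d \<in> unit_vectors"
  by (auto simp: unit_vectors_def turn_def)

lemma derived_walk:
  assumes w: "folding_walk P a"
  obtains Q b s t where "folding_walk Q b" "s = 1 \<or> s = -1"
    "\<And>e. odd_point e \<Longrightarrow> contract s e \<in> edge_sums Q \<Longrightarrow> e + (t + t) \<in> edge_sums P"
proof -
  have a: "complete_folding_seq a" and unit: "\<And>i. P (i + 1) - P i \<in> unit_vectors"
    and turn: "\<And>i. P (i + 2) - P (i + 1) = turn (a i) (P (i + 1) - P i)"
    using w by (auto simp: folding_walk_def)
  note sgn = complete_folding_seq_sign[OF a]
  obtain p b where b: "derived a p b" using complete_folding_seq_derived[OF a] .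
  \<comment> \<open>Taking \<open>P p\<close> as origin puts all \<open>V k\<close> on points of
    even coordinate sum, where \<open>undil\<close> is exact.\<close>
  define V where "V k = P (p + 2 * k) - P p" for k
  define d where "d k = P (p + 2 * k + 1) - P (p + 2 * k)" for k
  define \<eta> where "\<eta> k = a (p + 2 * k)" for k
  have d: "d k \<in> unit_vectors" for k using unit by (simp add: d_def)
  have mid: "P (p + 2 * k + 2) - P (p + 2 * k + 1) = turn (\<eta> k) (d k)" for k
    using turn[of "p + 2 * k"] by (simp add: d_def \<eta>_def)
  have V1: "V (k + 1) = V k + d k + turn (\<eta> k) (d k)" for k
    using mid[of k] by (simp add: V_def d_def algebra_simps)
  have d1: "d (k + 1) = turn (b k) (turn (\<eta> k) (d k))" for k
    using turn[of "p + 2 * k + 1"] mid[of k] derived_nth[OF b, of k]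
    by (simp add: d_def algebra_simps)
  have \<eta>: "\<eta> k = 1 \<or> \<eta> k = -1" for k using sgn by (simp add: \<eta>_def)
  have \<eta>1: "\<eta> (k + 1) = - \<eta> k" for k
    using derived_shift2[OF b, of "p + 2 * k"] by (simp add: \<eta>_def algebra_simps)
  have step: "even (fst (V (k + 1)) + snd (V (k + 1))) \<longleftrightarrow> even (fst (V k) + snd (V k))"
    "even (fst (V (k + 1))) \<longleftrightarrow> odd (fst (V k))" for k
    using d[of k] \<eta>[of k] unfolding V1 by (auto simp: unit_vectors_def turn_def)
  have inv: "even (fst (V k) + snd (V k)) \<and> \<eta> k = (if even (fst (V k)) then \<eta> 0 else - \<eta> 0)" for k
  proof (induction k rule: int_induct[where k = 0])
    case base
    then show ?case by (simp add: V_def)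
  next
    case (step1 i)
    then show ?case using step[of i] \<eta>1[of i] by auto
  next
    case (step2 i)
    then show ?case using step[of "i - 1"] \<eta>1[of "i - 1"] by auto
  qed
  define Q where "Q k = undil (V k)" for k
  have dQ: "dil (Q k) = V k" for k using inv by (simp add: Q_def dil_undil)
  \<comment> \<open>In complex notation the hypotenuse is \<open>d * (1 + i)\<close> or
    \<open>d * (1 - i)\<close>, and \<open>1 - i = -i * (1 + i)\<close>; hence the extra right turn
    when the fold is negative.\<close>
  have Q1: "Q (k + 1) - Q k = (if \<eta> k = 1 then d k else turn (- 1) (d k))" for k
  proof (rule dil_inj)
    have "dil (Q (k + 1) - Q k) = d k + turn (\<eta> k) (d k)"
      by (simp add: dil_diff dQ V1)
    also have "\<dots> = dil (if \<eta> k = 1 then d k else turn (- 1) (d k))"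
      using \<eta>[of k] by (auto simp: dil_def turn_def prod_eq_iff)
    finally show "dil (Q (k + 1) - Q k) = dil (if \<eta> k = 1 then d k else turn (- 1) (d k))" .
  qed
  have "folding_walk Q b"
    unfolding folding_walk_def
  proof (intro conjI allI)
    show "complete_folding_seq b" using b by (simp add: derived_def)
    fix k
    show "Q (k + 1) - Q k \<in> unit_vectors"
      unfolding Q1 using d turn_unit by auto
    have "Q (k + 2) - Q (k + 1) = (if \<eta> k = 1 then turn (- 1) (d (k + 1)) else d (k + 1))"
      using Q1[of "k + 1"] \<eta>1[of k] \<eta>[of k] by (auto simp: algebra_simps)
    also have "\<dots> = turn (b k) (if \<eta> k = 1 then d k else turn (- 1) (d k))"
      using \<eta>[of k] unfolding d1 by (auto simp: turn_def)
    finally show "Q (k + 2) - Q (k + 1) = turn (b k) (Q (k + 1) - Q k)" by (simp add: Q1)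
  qed
  moreover have "e + (P p + P p) \<in> edge_sums P"
    if e: "odd_point e" and c: "contract (\<eta> 0) e \<in> edge_sums Q" for e
  proof -
    obtain k where "contract (\<eta> 0) e = Q k + Q (k + 1)" using c by (auto simp: edge_sums_def)
    then have "e - offset (\<eta> 0) e = V k + V (k + 1)"
      using dil_contract[OF e \<eta>[of 0]] by (simp add: dil_add dQ)
    then have "e - offset (\<eta> 0) e = V k + V k + d k + turn (\<eta> k) (d k)"
      by (simp add: V1 add.assoc)
    then have "e = V k + V k + d k \<or> e = V k + V k + d k + d k + turn (\<eta> k) (d k)"
      using offset_cases[OF d] inv \<eta> e by blast
    moreover have "V k + V k + d k + (P p + P p) = P (p + 2 * k) + P (p + 2 * k + 1)"
      by (simp add: V_def d_def algebra_simps)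
    moreover have "V k + V k + d k + d k + turn (\<eta> k) (d k) + (P p + P p) =
        P (p + 2 * k + 1) + P (p + 2 * k + 1 + 1)"
      using mid[of k] by (simp add: V_def d_def algebra_simps)
    ultimately show ?thesis unfolding edge_sums_def by blast
  qed
  ultimately show ?thesis using that \<eta>[of 0] by blast
qed

section \<open>Growth of covered disks\<close>

definition covers_disk :: "(int \<Rightarrow> point) \<Rightarrow> real \<Rightarrow> bool" where
  "covers_disk P R \<longleftrightarrow>
     (\<exists>c. \<forall>e. odd_point e \<and> dist (to_plane e) c < R \<longrightarrow> e \<in> edge_sums P)"

text \<open>Dilation stretches distances by \<open>sqrt 2\<close>, and \<open>e\<close> lies at
  distance exactly 1 from \<open>dil (contract s e)\<close>; this distance is the loss in the
  radius.\<close>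

lemma covers_disk_expand:
  assumes Q: "covers_disk Q R" and s: "s = 1 \<or> s = -1"
    and PQ: "\<And>e. odd_point e \<Longrightarrow> contract s e \<in> edge_sums Q \<Longrightarrow> e + (t + t) \<in> edge_sums P"
  shows "covers_disk P (sqrt 2 * R - 1)"
proof -
  define D :: "real \<times> real \<Rightarrow> real \<times> real" where "D = (\<lambda>z. (fst z - snd z, fst z + snd z))"
  have normD: "norm (D z) = sqrt 2 * norm z" for z
  proof -
    have "(fst z - snd z)\<^sup>2 + (fst z + snd z)\<^sup>2 = 2 * ((fst z)\<^sup>2 + (snd z)\<^sup>2)"
      by (simp add: power2_eq_square algebra_simps)
    then show ?thesis
      by (cases z) (simp add: D_def norm_Pair flip: real_sqrt_mult)
  qed
  obtain c where c: "\<And>e. odd_point e \<Longrightarrow> dist (to_plane e) c < R \<Longrightarrow> e \<in> edge_sums Q"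
    using Q unfolding covers_disk_def by blast
  have "e' \<in> edge_sums P"
    if e': "odd_point e'" "dist (to_plane e') (D c + to_plane (t + t)) < sqrt 2 * R - 1" for e'
  proof -
    define e where "e = e' - (t + t)"
    have e: "odd_point e" using e'(1) by (simp add: e_def odd_point_def)
    define m where "m = contract s e"
    have "D (to_plane m - c) = to_plane (dil m) - D c"
      by (simp add: D_def to_plane_def dil_def)
    also have "\<dots> = (to_plane e' - (D c + to_plane (t + t))) - to_plane (offset s e)"
      using dil_contract[OF e s] by (simp add: m_def e_def to_plane_def prod_eq_iff)
    finally have "norm (D (to_plane m - c)) \<le>
        dist (to_plane e') (D c + to_plane (t + t)) + norm (to_plane (offset s e))"
      using norm_triangle_ineq4 by (metis dist_norm)
    moreover have "norm (to_plane (offset s e)) = 1"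
      using s sgn4_cases[of "fst e"] sgn4_cases[of "snd e"]
      by (auto simp: to_plane_def offset_def norm_Pair)
    ultimately have "sqrt 2 * norm (to_plane m - c) < sqrt 2 * R"
      using e'(2) unfolding normD by linarith
    then have "dist (to_plane m) c < R" by (simp add: dist_norm)
    then have "m \<in> edge_sums Q" using c odd_point_contract[OF e s] by (simp add: m_def)
    then show ?thesis using PQ[OF e] by (simp add: m_def e_def)
  qed
  then show ?thesis unfolding covers_disk_def by blast
qed

fun contracts :: "int list \<Rightarrow> point \<Rightarrow> point" where
  "contracts [] e = e"
| "contracts (s # ss) e = contracts ss (contract s e)"

text \<open>Up to translation, \<open>n\<close> unfoldings of an edge depend only on
  \<open>n\<close> signs and on whether the edge is horizontal or vertical. This leaves finitely
  many cases to check.\<close>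

lemma iterated_contract:
  assumes "folding_walk P a"
  shows "\<exists>ss e0 t. length ss = n \<and> set ss \<subseteq> {1, -1} \<and> e0 \<in> {(1, 0), (0, 1)} \<and>
    (\<forall>e. odd_point e \<longrightarrow> contracts ss e = e0 \<longrightarrow> e + (t + t) \<in> edge_sums P)"
  using assms
proof (induction n arbitrary: P a)
  case 0
  have "P (0 + 1) - P 0 \<in> unit_vectors" using 0 unfolding folding_walk_def by blast
  then have "P 1 - P 0 \<in> unit_vectors" by simp
  then have "P 1 - P 0 \<in> {(1, 0), (0, 1)} \<or> - (P 1 - P 0) \<in> {(1, 0), (0, 1)}"
    unfolding unit_vectors_def by fastforce
  moreover have "P 0 + P 1 \<in> edge_sums P"
    unfolding edge_sums_def by (rule range_eqI[of _ _ 0]) simp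
  \<comment> \<open>Basing the edge at one endpoint or the other makes its vector positive, so two
    initial edges suffice.\<close>
  moreover have "P 0 + P 1 = (P 1 - P 0) + (P 0 + P 0)" "P 0 + P 1 = - (P 1 - P 0) + (P 1 + P 1)"
    by simp_all
  ultimately obtain e0 t where "e0 \<in> {(1, 0), (0, 1)}" "e0 + (t + t) \<in> edge_sums P"
    by metis
  then show ?case
    by (intro exI[of _ "[]"] exI[of _ e0] exI[of _ t]) auto
next
  case (Suc n)
  obtain Q b s t where Q: "folding_walk Q b" and s: "s = 1 \<or> s = -1"
    and PQ: "\<And>e. odd_point e \<Longrightarrow> contract s e \<in> edge_sums Q \<Longrightarrow> e + (t + t) \<in> edge_sums P"
    using derived_walk[OF Suc.prems] by metis
  obtain ss e0 t' where ss: "length ss = n" "set ss \<subseteq> {1, -1}" "e0 \<in> {(1, 0), (0, 1)}"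
    and t': "\<And>e. odd_point e \<Longrightarrow> contracts ss e = e0 \<Longrightarrow> e + (t' + t') \<in> edge_sums Q"
    using Suc.IH[OF Q] by blast
  define s' where "s' = (if even (fst t' + snd t') then s else - s)"
  have s1: "s' = 1 \<or> s' = -1" using s by (auto simp: s'_def)
  have "e + ((dil t' + t) + (dil t' + t)) \<in> edge_sums P"
    if e: "odd_point e" "contracts (s' # ss) e = e0" for e
  proof -
    have "contract s' e + (t' + t') \<in> edge_sums Q"
      using t' odd_point_contract[OF e(1) s1] e(2) by simp
    then have "contract s (e + (dil t' + dil t')) \<in> edge_sums Q"
      using contract_translate[OF e(1) s s'_def] by simp
    moreover have "odd_point (e + (dil t' + dil t'))"
      using e(1) by (simp add: odd_point_def dil_def)
    ultimately have "e + (dil t' + dil t') + (t + t) \<in> edge_sums P" using PQ by blast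
    then show ?thesis by (simp add: ac_simps)
  qed
  then show ?case
    using ss s1 by (intro exI[of _ "s' # ss"] exI[of _ e0] exI[of _ "dil t' + t"]) auto
qed


text \<open>
  The vectors at distance less than \<open>2.42\<close> from \<open>(1/2, 0)\<close>. Unfolding turns a covered disk of
  radius \<open>R\<close> into one of radius \<open>sqrt 2 * R - 1\<close>, which grows once \<open>R\<close> exceeds \<open>1 + sqrt 2\<close>.
\<close>
definition seed_offsets :: "point list" where
  "seed_offsets = [(0, 0), (1, 0), (0, 1), (1, 1), (0, -1), (1, -1), (0, 2), (1, 2), (0, -2), (1, -2),
     (-1, 0), (-1, 1), (-1, -1), (2, 0), (2, 1), (2, -1)]"

text \<open>Found by a computer search.\<close>
definition seed_points :: "point list" where
  "seed_points = [(-2, -5), (2, -7), (-7, -3), (5, -1), (-7, -1), (-3, -7), (-2, -3), (1, -6), (2, -3),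
     (8, -3), (-10, -3), (-7, -5), (-5, 1), (-4, -9), (3, -9), (4, 1), (6, -5), (-2, -7), (-3, -3),
     (-2, 3), (-7, -11), (-6, -1), (6, -11), (1, 3), (6, -1), (1, -3), (10, -1), (1, -5), (6, -3)]"

text \<open>
  Five unfoldings of a single edge always cover such a disk. The first entry of \<open>ss\<close> encodes the
  direction of the initial edge. Unlike \<open>list_all\<close> and \<open>list_ex\<close>, \<open>find\<close> is evaluated lazily by
  the simplifier.
\<close>
lemma seed_check:
  "find (\<lambda>ss. find (\<lambda>c. find (\<lambda>f. if even (fst c + fst f + (snd c + snd f)) then False
      else contracts (tl ss) (fst c + fst f, snd c + snd f) \<noteq> (if hd ss = 1 then (1, 0) else (0, 1)))
    seed_offsets = None) seed_points = None) (List.n_lists 6 [1, -1]) = None"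
  by code_simp

text \<open>The left side is four times the squared distance to \<open>(1/2, 0)\<close>. Four times
  the square of 2.42 is below 24, so the bound for integers is 23.\<close>

lemma seed_offsets_complete:
  assumes "(2 * x - 1)\<^sup>2 + (2 * y)\<^sup>2 \<le> (23 :: int)"
  shows "(x, y) \<in> set seed_offsets"
proof -
  have bound: "\<bar>z\<bar> \<le> 4" if "z\<^sup>2 \<le> 23" for z :: int
  proof (rule ccontr)
    assume "\<not> \<bar>z\<bar> \<le> 4"
    then have "5\<^sup>2 \<le> \<bar>z\<bar>\<^sup>2" by (intro power_mono) auto
    then show False using that by simp
  qed
  have "(2 * x - 1)\<^sup>2 \<le> 23" "(2 * y)\<^sup>2 \<le> 23"
    using assms zero_le_power2[of "2 * x - 1"] zero_le_power2[of "2 * y"] by linarith+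
  then have "\<bar>2 * x - 1\<bar> \<le> 4" "\<bar>2 * y\<bar> \<le> 4" using bound by blast+
  then have "x = -1 \<or> x = 0 \<or> x = 1 \<or> x = 2" "y = -2 \<or> y = -1 \<or> y = 0 \<or> y = 1 \<or> y = 2"
    by linarith+
  then show ?thesis using assms by (elim disjE) (simp_all add: seed_offsets_def)
qed

lemma covers_seed_disk:
  assumes "folding_walk P a"
  shows "covers_disk P (121/50)"
proof -
  obtain ss e0 t where ss: "length ss = 5" "set ss \<subseteq> {1, -1}" "e0 \<in> {(1, 0), (0, 1)}"
    and P: "\<And>e. odd_point e \<Longrightarrow> contracts ss e = e0 \<Longrightarrow> e + (t + t) \<in> edge_sums P"
    using iterated_contract[OF assms, of 5] by blast
  define h :: int where "h = (if e0 = (1, 0) then 1 else -1)"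
  have "h # ss \<in> set (List.n_lists 6 [1, -1])"
    using ss by (auto simp: set_n_lists h_def)
  \<comment> \<open>The nested \<open>find\<close> read as quantifiers: every \<open>ss\<close> has
    a centre \<open>c\<close> for which no offset \<open>f\<close> violates the equation.\<close>
  with seed_check[unfolded find_None_iff] obtain c where
    bad: "\<not> (\<exists>f. f \<in> set seed_offsets \<and> (if even (fst c + fst f + (snd c + snd f)) then False
      else contracts (tl (h # ss)) (fst c + fst f, snd c + snd f) \<noteq>
        (if hd (h # ss) = 1 then (1, 0) else (0, 1))))" by blast
  have e0: "(if h = 1 then (1, 0) else (0, 1)) = e0"
    using ss(3) by (auto simp: h_def)
  have c: "contracts ss (c + f) = e0" if f: "f \<in> set seed_offsets" "odd_point (c + f)" for f
  proof -
    have "\<not> even (fst c + fst f + (snd c + snd f))"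
      using f(2) unfolding odd_point_def fst_add snd_add .
    with bad f(1) have "contracts ss (fst c + fst f, snd c + snd f) = (if h = 1 then (1, 0) else (0, 1))"
      unfolding list.sel by metis
    then show ?thesis by (simp only: e0 plus_prod_def)
  qed
  show ?thesis
    unfolding covers_disk_def
  proof (intro exI[of _ "to_plane (c + (t + t)) + (1/2, 0)"] allI impI)
    fix e assume e: "odd_point e \<and> dist (to_plane e) (to_plane (c + (t + t)) + (1/2, 0)) < 121/50"
    define f where "f = e - (t + t) - c"
    obtain x y where xy: "f = (x, y)" by (cases f)
    have ef: "e = c + f + (t + t)" by (simp add: f_def)
    have "dist (to_plane e) (to_plane (c + (t + t)) + (1/2, 0)) = norm (real_of_int x - 1/2, real_of_int y)"
      by (simp add: ef xy to_plane_def dist_norm)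
    also have "\<dots> = sqrt ((real_of_int x - 1/2)\<^sup>2 + (real_of_int y)\<^sup>2)"
      by (simp add: norm_Pair)
    finally have "sqrt ((real_of_int x - 1/2)\<^sup>2 + (real_of_int y)\<^sup>2) < 121/50" using e by simp
    then have "(sqrt ((real_of_int x - 1/2)\<^sup>2 + (real_of_int y)\<^sup>2))\<^sup>2 < (121/50)\<^sup>2"
      by (intro power_strict_mono) auto
    then have less: "(real_of_int x - 1/2)\<^sup>2 + (real_of_int y)\<^sup>2 < 6"
      by (simp only: real_sqrt_pow2 sum_power2_ge_zero) (simp add: power2_eq_square)
    have eq: "real_of_int ((2 * x - 1)\<^sup>2 + (2 * y)\<^sup>2) =
        4 * ((real_of_int x - 1/2)\<^sup>2 + (real_of_int y)\<^sup>2)"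
      by (simp add: power2_eq_square algebra_simps)
    have "real_of_int ((2 * x - 1)\<^sup>2 + (2 * y)\<^sup>2) < 24" unfolding eq using less by simp
    then have "(2 * x - 1)\<^sup>2 + (2 * y)\<^sup>2 \<le> (23 :: int)" by linarith
    then have "f \<in> set seed_offsets" using seed_offsets_complete xy by simp
    moreover have "odd_point (c + f)" using e unfolding ef by (simp add: odd_point_def)
    ultimately show "e \<in> edge_sums P" using c P unfolding ef by blast
  qed
qed

text \<open>The map taking \<open>R\<close> to \<open>sqrt 2 * R - 1\<close> has fixed point
  \<open>1 + sqrt 2\<close>, and the deviation from it is multiplied by \<open>sqrt 2\<close> at
  each unfolding.\<close>

lemma covers_large_disk:
  assumes "folding_walk P a"
  shows "covers_disk P ((1 + sqrt 2) + (121/50 - (1 + sqrt 2)) * sqrt 2 ^ n)"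
  using assms
proof (induction n arbitrary: P a)
  case 0
  then show ?case using covers_seed_disk by simp
next
  case (Suc n)
  obtain Q b s t where Q: "folding_walk Q b" and s: "s = 1 \<or> s = -1"
    and PQ: "\<And>e. odd_point e \<Longrightarrow> contract s e \<in> edge_sums Q \<Longrightarrow> e + (t + t) \<in> edge_sums P"
    using derived_walk[OF Suc.prems] by metis
  have "sqrt 2 * ((1 + sqrt 2) + (121/50 - (1 + sqrt 2)) * sqrt 2 ^ n) - 1 =
      (1 + sqrt 2) + (121/50 - (1 + sqrt 2)) * sqrt 2 ^ Suc n"
    by (simp add: algebra_simps)
  then show ?case using covers_disk_expand[OF Suc.IH[OF Q] s PQ] by metis
qed

lemma covers_every_radius:
  assumes "folding_walk P a"
  shows "covers_disk P R"
proof -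
  \<comment> \<open>This is the reason for the seed radius: 121/50 exceeds the fixed point
    \<open>1 + sqrt 2\<close>.\<close>
  have "sqrt 2 < 71/50" by (rule real_less_lsqrt) (auto simp: power2_eq_square)
  then have pos: "121/50 - (1 + sqrt 2) > 0" by simp
  obtain n where "R / (121/50 - (1 + sqrt 2)) < sqrt 2 ^ n"
    using real_arch_pow[of "sqrt 2"] by auto
  then have "R < (121/50 - (1 + sqrt 2)) * sqrt 2 ^ n"
    using pos by (simp add: divide_less_eq mult.commute)
  then have "R \<le> (1 + sqrt 2) + (121/50 - (1 + sqrt 2)) * sqrt 2 ^ n"
    by (smt (verit) real_sqrt_ge_zero)
  then show ?thesis
    using covers_large_disk[OF assms, of n] unfolding covers_disk_def by (meson less_le_trans)
qed

section \<open>Curves and coverings\<close>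

definition decorate :: "(int \<Rightarrow> seg) \<Rightarrow> int \<Rightarrow> decorated" where
  "decorate C i = (C i, seg_support (C (i - 1)), seg_support (C (i + 1)))"

definition shift_seg :: "point \<Rightarrow> seg \<Rightarrow> seg" where
  "shift_seg v s = (v + fst s, v + snd s)"

lemma decorated_segments_eq: "decorated_segments \<C> = {decorate C i | C i. C \<in> \<C>}"
  by (simp add: decorated_segments_def decorate_def)

lemma seg_support_shift: "seg_support (shift_seg v s) = (+) v ` seg_support s"
  by (simp add: seg_support_def shift_seg_def)

lemma direction_shift [simp]: "direction (shift_seg v s) = direction s"
  by (simp add: direction_def shift_seg_def)

lemma horizontal_shift [simp]: "horizontal (shift_seg v s) = horizontal s"
  by (simp add: horizontal_def shift_seg_def)

lemma translate_decorate:
  "translate v (decorate C i) =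
    (shift_seg v (C i), (+) v ` seg_support (C (i - 1)), (+) v ` seg_support (C (i + 1)))"
  by (cases "C i") (simp add: translate_def decorate_def shift_seg_def)

lemma translate_translate: "translate u (translate v d) = translate (u + v) d"
  by (auto simp: translate_def image_image add.assoc split: prod.splits)

lemma direction_unit: "is_segment s \<longleftrightarrow> direction s \<in> unit_vectors"
  by (simp add: is_segment_def unit_vectors_def)

lemma curve_turn:
  assumes "complete_curve C"
  shows "direction (C (i + 1)) = turn (assoc_seq C i) (direction (C i))"
proof -
  have "direction (C i) \<in> unit_vectors" "direction (C (i + 1)) \<in> unit_vectors"
    "perpendicular (C i) (C (i + 1))"
    using assms by (auto simp: complete_curve_def direction_unit)
  then show ?thesis
    by (auto simp: unit_vectors_def perpendicular_def assoc_seq_def rotate_left_def turn_def)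
qed

lemma curve_next:
  assumes "complete_curve C"
  shows "fst (C (i + 1)) = snd (C i)"
  using assms by (simp add: complete_curve_def)

lemma folding_walk_curve:
  assumes "complete_folding_curve C"
  shows "folding_walk (\<lambda>i. fst (C i)) (assoc_seq C)"
proof -
  have C: "complete_curve C" "complete_folding_seq (assoc_seq C)"
    using assms by (auto simp: complete_folding_curve_def)
  have d: "fst (C (i + 1)) - fst (C i) = direction (C i)" for i
    by (simp add: direction_def curve_next[OF C(1)])
  have "fst (C (i + 2)) - fst (C (i + 1)) = direction (C (i + 1))" for i
    using d[of "i + 1"] by (simp add: algebra_simps)
  then show ?thesis
    using C curve_turn[OF C(1)] unfolding folding_walk_def d
    by (auto simp: complete_curve_def direction_unit)
qed

lemma horizontal_direction: "horizontal s \<longleftrightarrow> snd (direction s) = 0"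
  by (auto simp: horizontal_def direction_def)

lemma horizontal_step:
  assumes "complete_curve C"
  shows "horizontal (C (i + 1)) \<longleftrightarrow> \<not> horizontal (C i)"
proof -
  have "direction (C i) \<in> unit_vectors" "direction (C (i + 1)) \<in> unit_vectors"
    "perpendicular (C i) (C (i + 1))"
    using assms by (auto simp: complete_curve_def direction_unit)
  then show ?thesis
    by (auto simp: unit_vectors_def perpendicular_def horizontal_direction)
qed

lemma horizontal_parity:
  assumes "complete_curve C"
  shows "horizontal (C (i + k)) \<longleftrightarrow> (horizontal (C i) \<longleftrightarrow> even k)"
proof (induction k rule: int_induct[where k = 0])
  case (step1 k)
  then show ?case using horizontal_step[OF assms, of "i + k"] by (simp add: add.assoc)
next
  case (step2 k)
  then show ?case using horizontal_step[OF assms, of "i + (k - 1)"] by (auto simp: add.assoc)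
qed simp

lemma vertical_iff:
  assumes "is_segment s"
  shows "vertical s \<longleftrightarrow> \<not> horizontal s"
  using assms by (auto simp: is_segment_def vertical_def horizontal_def direction_def prod_eq_iff)

text \<open>Position \<open>p + 1\<close> lies in \<open>E1\<close>, and horizontal and vertical
  segments alternate, so this one segment determines the type.\<close>

lemma same_type_iff:
  assumes C: "complete_folding_curve C" and D: "complete_folding_curve D"
    and p: "derived (assoc_seq C) p b" and q: "derived (assoc_seq D) q c"
  shows "same_type C D \<longleftrightarrow> (horizontal (C (p + 1)) \<longleftrightarrow> horizontal (D (q + 1)))"
proof -
  have *: "(type_H C \<longleftrightarrow> horizontal (C (p + 1))) \<and> (type_V C \<longleftrightarrow> \<not> horizontal (C (p + 1)))"
    if C: "complete_folding_curve C" and p: "derived (assoc_seq C) p b" for C p b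
  proof -
    have cc: "complete_curve C" and "complete_folding_seq (assoc_seq C)"
      using C by (auto simp: complete_folding_curve_def)
    then have E1: "E1 (assoc_seq C) = {i. odd (i - p)}"
      using E1_derived[OF p] complete_folding_seq_sign by blast
    have "horizontal (C i) \<longleftrightarrow> horizontal (C (p + 1))" if "odd (i - p)" for i
      using horizontal_parity[OF cc, of "p + 1" "i - (p + 1)"] that by simp
    moreover have "vertical (C i) \<longleftrightarrow> \<not> horizontal (C i)" for i
      using vertical_iff cc by (auto simp: complete_curve_def)
    moreover have "odd (p + 1 - p)" by simp
    ultimately show ?thesis
      unfolding type_H_def type_V_def E1 by blast
  qed
  show ?thesis unfolding same_type_def using *[OF C p] *[OF D q] by blast
qed

lemma same_sum_support:
  assumes "is_segment s" "is_segment t" "fst s + snd s = fst t + snd t"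
  shows "seg_support s = seg_support t"
proof -
  obtain x y d where s: "s = ((x, y), (x, y) + d)" "d \<in> unit_vectors"
    using assms(1) by (metis direction_unit direction_def add.commute diff_add_cancel prod.collapse)
  obtain x' y' d' where t: "t = ((x', y'), (x', y') + d')" "d' \<in> unit_vectors"
    using assms(2) by (metis direction_unit direction_def add.commute diff_add_cancel prod.collapse)
  have "fst d + 2 * x = fst d' + 2 * x'" "snd d + 2 * y = snd d' + 2 * y'"
    using assms(3) by (simp_all add: s(1) t(1) prod_eq_iff)
  then have "d = d' \<and> x = x' \<and> y = y' \<or> d = - d' \<and> x = x' + fst d' \<and> y = y' + snd d'"
    using s(2) t(2) unfolding unit_vectors_def by (auto; presburger)
  then show ?thesis
    by (cases d') (auto simp: s(1) t(1) seg_support_def)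
qed

lemma covering_unique:
  assumes "covering \<C>" "C \<in> \<C>" "D \<in> \<C>" "seg_support (C i) = seg_support (D j)"
  shows "C = D \<and> i = j"
proof -
  have "is_segment (C i)"
    using assms by (auto simp: covering_def complete_folding_curve_def complete_curve_def)
  then have "seg_support (C i) \<in> unit_edges"
    unfolding unit_edges_def by blast
  then have "\<exists>!p. fst p \<in> \<C> \<and> seg_support ((fst p) (snd p)) = seg_support (C i)"
    using assms(1) by (auto simp: covering_def)
  moreover have "fst (C, i) \<in> \<C> \<and> seg_support (fst (C, i) (snd (C, i))) = seg_support (C i)"
    "fst (D, j) \<in> \<C> \<and> seg_support (fst (D, j) (snd (D, j))) = seg_support (C i)"
    using assms by simp_all
  ultimately have "(C, i) = (D, j)" by blast
  then show ?thesis by simp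
qed

lemma covering_nonempty:
  assumes "covering \<C>"
  obtains C where "C \<in> \<C>"
proof -
  have "is_segment ((0, 0), (1, 0))" by (simp add: is_segment_def direction_def)
  then have "seg_support ((0, 0), (1, 0)) \<in> unit_edges" unfolding unit_edges_def by blast
  then show ?thesis using assms that unfolding covering_def by blast
qed

text \<open>
  Each curve covers arbitrarily large disks, so the local isomorphism property lets any finite
  pattern of the covering be found inside any prescribed curve.
\<close>
lemma pattern_in_curve:
  assumes cov: "covering \<C>" and lip: "local_isomorphism_property \<C>" and C: "C \<in> \<C>"
    and F: "finite F" "F \<subseteq> decorated_segments \<C>"
  obtains v where "\<And>d. d \<in> F \<Longrightarrow> \<exists>j. translate v d = decorate C j"
proof -
  obtain r where r: "\<forall>c. \<exists>v. translate v ` F \<subseteq> decorated_segments \<C> \<and>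
      (\<forall>d \<in> translate v ` F. to_plane ` vertices d \<subseteq> cball c r)"
    using lip F unfolding local_isomorphism_property_def by meson
  have Cf: "complete_folding_curve C" using cov C by (simp add: covering_def)
  then have cc: "complete_curve C" by (simp add: complete_folding_curve_def)
  \<comment> \<open>Edges are encoded by doubled midpoints, so a disk of radius \<open>r\<close>
    about \<open>c2\<close> becomes one of radius \<open>2 * r\<close> about \<open>c\<close>; the
    extra 1 makes the inequality strict.\<close>
  obtain c where c: "\<And>e. odd_point e \<Longrightarrow> dist (to_plane e) c < 2 * r + 1 \<Longrightarrow>
      e \<in> edge_sums (\<lambda>i. fst (C i))"
    using covers_every_radius[OF folding_walk_curve[OF Cf]] unfolding covers_disk_def by blast
  define c2 where "c2 = (1 / 2) *\<^sub>R c"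
  obtain v where v: "translate v ` F \<subseteq> decorated_segments \<C>"
    "\<And>d. d \<in> translate v ` F \<Longrightarrow> to_plane ` vertices d \<subseteq> cball c2 r"
    using r by meson
  have "\<exists>j. translate v d = decorate C j" if d: "d \<in> F" for d
  proof -
    obtain D i where D: "D \<in> \<C>" "translate v d = decorate D i"
      using v(1) d unfolding decorated_segments_eq by blast
    have seg: "is_segment (D i)"
      using cov D(1) by (auto simp: covering_def complete_folding_curve_def complete_curve_def)
    have "{fst (D i), snd (D i)} \<subseteq> vertices (translate v d)"
      by (auto simp: D(2) vertices_def decorate_def seg_support_def)
    then have near: "dist c2 (to_plane (fst (D i))) \<le> r" "dist c2 (to_plane (snd (D i))) \<le> r"
      using v(2)[of "translate v d"] d
      by (metis (no_types, lifting) image_eqI image_subset_iff insert_subset mem_cball)+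
    define e where "e = fst (D i) + snd (D i)"
    have "e = fst (D i) + fst (D i) + direction (D i)" by (simp add: e_def direction_def)
    then have odd: "odd_point e"
      using seg by (auto simp: odd_point_def is_segment_def)
    have "to_plane e - c = (to_plane (fst (D i)) - c2) + (to_plane (snd (D i)) - c2)"
      by (simp add: e_def to_plane_def c2_def prod_eq_iff)
    then have "dist (to_plane e) c \<le> dist (to_plane (fst (D i))) c2 + dist (to_plane (snd (D i))) c2"
      by (metis dist_norm norm_triangle_ineq)
    then have "dist (to_plane e) c < 2 * r + 1" using near by (simp add: dist_commute)
    then obtain j where "e = fst (C j) + fst (C (j + 1))"
      using c odd unfolding edge_sums_def by blast
    then have "seg_support (D i) = seg_support (C j)"
      using seg cc by (intro same_sum_support) (auto simp: e_def complete_curve_def)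
    then have "D = C" using covering_unique[OF cov D(1) C] by blast
    then show ?thesis using D by blast
  qed
  then show ?thesis using that by blast
qed

section \<open>Arcs and the transfer of patterns\<close>

text \<open>The bounds on \<open>l\<close> are strict because a decoration involves both
  neighbouring segments.\<close>

lemma translate_arc:
  assumes "\<And>j. j \<le> m \<Longrightarrow> D (k + int j) = shift_seg v (C (i + int j))"
    and "i < l" "l < i + int m"
  shows "translate v (decorate C l) = decorate D (l - i + k)"
proof -
  have D: "D (l' - i + k) = shift_seg v (C l')" if "i \<le> l'" "l' \<le> i + int m" for l'
    using assms(1)[of "nat (l' - i)"] that by (simp add: algebra_simps)
  have "D (l - i + k) = shift_seg v (C l)" "D (l - i + k - 1) = shift_seg v (C (l - 1))"
    "D (l - i + k + 1) = shift_seg v (C (l + 1))"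
    using D[of l] D[of "l - 1"] D[of "l + 1"] assms(2,3) by (simp_all add: algebra_simps)
  then show ?thesis
    unfolding translate_decorate by (simp add: decorate_def seg_support_shift)
qed

lemma assoc_seq_arc:
  assumes "\<And>j. j \<le> m \<Longrightarrow> D (k + int j) = shift_seg v (C (i + int j))" "j < m"
  shows "assoc_seq D (k + int j) = assoc_seq C (i + int j)"
  using assms(1)[of j] assms(1)[of "Suc j"] assms(2)
  by (simp add: assoc_seq_def ac_simps)

lemma arc_unique:
  assumes C: "complete_curve C" and D: "complete_curve D" and dir: "direction (D k) = direction (C i)"
    and eq: "\<And>j. j < m \<Longrightarrow> assoc_seq D (k + int j) = assoc_seq C (i + int j)"
    and "j \<le> m"
  shows "D (k + int j) = shift_seg (fst (D k) - fst (C i)) (C (i + int j))"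
proof -
  define v where "v = fst (D k) - fst (C i)"
  have "direction (D (k + int j)) = direction (C (i + int j)) \<and> fst (D (k + int j)) = v + fst (C (i + int j))"
    using \<open>j \<le> m\<close>
  proof (induction j)
    case 0
    then show ?case using dir by (simp add: v_def)
  next
    case (Suc j)
    then have IH: "direction (D (k + int j)) = direction (C (i + int j))"
      "fst (D (k + int j)) = v + fst (C (i + int j))" by simp_all
    then have "snd (D (k + int j)) = v + snd (C (i + int j))"
      by (simp add: direction_def algebra_simps)
    then show ?case
      using curve_turn[OF C, of "i + int j"] curve_turn[OF D, of "k + int j"]
        curve_next[OF C, of "i + int j"] curve_next[OF D, of "k + int j"] eq[of j] Suc.prems IH
      by (simp add: ac_simps)
  qed
  then show ?thesis
    by (simp add: shift_seg_def direction_def prod_eq_iff v_def)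
qed

lemma direction_turn_sign:
  assumes "complete_curve C"
  shows "direction (C (i + 2 * int n)) =
    (turn_sign (assoc_seq C) i n * fst (direction (C i)), turn_sign (assoc_seq C) i n * snd (direction (C i)))"
proof (induction n)
  case (Suc n)
  have "direction (C (i + 2 * int n + 1 + 1)) =
      turn (assoc_seq C (i + 2 * int n + 1)) (turn (assoc_seq C (i + 2 * int n)) (direction (C (i + 2 * int n))))"
    by (simp only: curve_turn[OF assms])
  then show ?case
    unfolding Suc by (simp add: turn_def turn_sign_Suc algebra_simps)
qed simp

lemma turn_sign_cong:
  assumes "\<And>j. j < 2 * n \<Longrightarrow> b (k + int j) = a (i + int j)"
  shows "turn_sign b k n = turn_sign a i n"
  unfolding turn_sign_def
proof (rule prod.cong)
  fix j assume "j \<in> {..<n}"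
  then show "- b (k + 2 * int j) * b (k + 2 * int j + 1) = - a (i + 2 * int j) * a (i + 2 * int j + 1)"
    using assms[of "2 * j"] assms[of "2 * j + 1"] by (simp add: algebra_simps)
qed simp

text \<open>
  A common subword fixes an arc up to a rotation, which is by 0 or 180 degrees since the types
  agree; the recurrence of the subword with the opposite direction excludes the second case.
\<close>
lemma arc_in_curve:
  assumes C: "complete_folding_curve C" and D: "complete_folding_curve D"
    and type: "same_type C D" and sub: "subwords (assoc_seq C) \<subseteq> subwords (assoc_seq D)"
  obtains k v where "\<And>j. j \<le> m \<Longrightarrow> D (k + int j) = shift_seg v (C (i + int j))"
proof -
  define a b where "a = assoc_seq C" and "b = assoc_seq D"
  have cc: "complete_curve C" "complete_curve D" and cf: "complete_folding_seq a" "complete_folding_seq b"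
    using C D by (auto simp: complete_folding_curve_def a_def b_def)
  \<comment> \<open>Eight extra letters locate the finest fold through
    \<open>derived_parity_unique\<close>.\<close>
  define m' where "m' = m + 8"
  obtain n where n: "\<And>j. j < m' \<Longrightarrow> a (i + int j + 2 * int n) = a (i + int j)" "turn_sign a i n = -1"
    using half_turn_window[OF cf(1)] by blast
  \<comment> \<open>The subword is long enough to contain the window and its recurrence
    \<open>2 * n\<close> steps later.\<close>
  have "map (\<lambda>j. a (i + int j)) [0..<m' + 2 * n] \<in> subwords b"
    using sub unfolding a_def[symmetric] b_def[symmetric] by (auto simp: subwords_eq[of a])
  then obtain k l where "map (\<lambda>j. a (i + int j)) [0..<m' + 2 * n] = map (\<lambda>j. b (k + int j)) [0..<l]"
    unfolding subwords_eq[of b] by blast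
  then have k: "b (k + int j) = a (i + int j)" if "j < m' + 2 * n" for j
    using that by (metis (mono_tags, lifting) add_0 diff_zero length_map length_upt nth_map nth_upt)
  obtain p c where p: "derived a p c" using complete_folding_seq_derived[OF cf(1)] .
  obtain q d where q: "derived b q d" using complete_folding_seq_derived[OF cf(2)] .
  have "even (i - p) \<longleftrightarrow> even (k - q)"
    using derived_parity_unique[OF p q] k by (simp add: m'_def)
  moreover have "horizontal (C (p + 1)) \<longleftrightarrow> horizontal (D (q + 1))"
    using same_type_iff[OF C D] p q type by (simp add: a_def b_def)
  ultimately have "horizontal (C i) \<longleftrightarrow> horizontal (D k)"
    using horizontal_parity[OF cc(1), of "p + 1" "i - (p + 1)"]
      horizontal_parity[OF cc(2), of "q + 1" "k - (q + 1)"] by auto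
  moreover have "is_segment (C i)" "is_segment (D k)"
    using cc by (auto simp: complete_curve_def)
  ultimately have dir: "direction (D k) = direction (C i) \<or> direction (D k) = - direction (C i)"
    unfolding is_segment_def horizontal_direction by (auto simp: prod_eq_iff)
  show ?thesis
  proof (cases "direction (D k) = direction (C i)")
    case True
    have "assoc_seq D (k + int j) = assoc_seq C (i + int j)" if "j < m" for j
      using k[of j] that by (simp add: a_def b_def m'_def)
    from arc_unique[OF cc True this] show ?thesis using that by blast
  next
    case False
    \<comment> \<open>If \<open>D k\<close> points the wrong way, the arc is taken from the
      recurrence instead, where the turns are the same and the direction is reversed.\<close>
    have "turn_sign b k n = -1" using turn_sign_cong[of n b k a i] k n(2) by simp
    then have "direction (D (k + 2 * int n)) = - direction (D k)"
      using direction_turn_sign[OF cc(2), of k n] by (simp add: b_def prod_eq_iff)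
    then have dir': "direction (D (k + 2 * int n)) = direction (C i)" using dir False by simp
    have "assoc_seq D (k + 2 * int n + int j) = assoc_seq C (i + int j)" if "j < m" for j
      using k[of "2 * n + j"] n(1)[of j] that by (simp add: a_def b_def m'_def ac_simps)
    from arc_unique[OF cc dir' this] show ?thesis using that by blast
  qed
qed

lemma pattern_transfer:
  assumes cov: "covering \<C>" and lip: "local_isomorphism_property \<C>" and C: "C \<in> \<C>"
    and D: "D \<in> \<D>" "complete_folding_curve D" and type: "same_type C D"
    and sub: "subwords (assoc_seq C) \<subseteq> subwords (assoc_seq D)"
    and F: "finite F" "F \<subseteq> decorated_segments \<C>"
  shows "\<exists>v. translate v ` F \<subseteq> decorated_segments \<D>"
proof -
  have Cf: "complete_folding_curve C" using cov C by (simp add: covering_def)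
  obtain v where "\<And>d. d \<in> F \<Longrightarrow> \<exists>j. translate v d = decorate C j"
    using pattern_in_curve[OF cov lip C F] by blast
  then obtain f where f: "\<And>d. d \<in> F \<Longrightarrow> translate v d = decorate C (f d)" by metis
  \<comment> \<open>The added 0 keeps \<open>Min\<close> and \<open>Max\<close> meaningful when
    \<open>F\<close> is empty.\<close>
  define J where "J = insert 0 (f ` F)"
  have J: "finite J" "0 \<in> J" using F by (simp_all add: J_def)
  \<comment> \<open>One position is added at either end, as required by the strict bounds of
    \<open>translate_arc\<close>.\<close>
  define i where "i = Min J - 1"
  define m where "m = nat (Max J - i + 1)"
  have in_J: "i < l \<and> l < i + int m" if "l \<in> J" for l
    using Min_le[OF J(1) that] Max_ge[OF J(1) that] by (simp add: i_def m_def)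
  obtain k u where u: "\<And>j. j \<le> m \<Longrightarrow> D (k + int j) = shift_seg u (C (i + int j))"
    using arc_in_curve[OF Cf D(2) type sub] by blast
  have "translate (u + v) d \<in> decorated_segments \<D>" if "d \<in> F" for d
  proof -
    have "f d \<in> J" using that by (simp add: J_def)
    then have "translate u (decorate C (f d)) = decorate D (f d - i + k)"
      using translate_arc[of m D k u C i] u in_J by blast
    then have "translate (u + v) d = decorate D (f d - i + k)"
      using f[OF that] by (metis translate_translate)
    then show ?thesis using D(1) unfolding decorated_segments_eq by blast
  qed
  then show ?thesis by blast
qed

text \<open>Translating the pattern only places each segment of the arc somewhere on
  \<open>D\<close>. The decorations record the next support, and supports on \<open>D\<close> are
  distinct, so consecutive segments stay consecutive.\<close>

lemma arc_transfer:
  assumes cov: "covering \<D>" and lip: "local_isomorphism_property \<D>"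
    and li: "\<And>F. finite F \<Longrightarrow> F \<subseteq> decorated_segments \<C> \<Longrightarrow> \<exists>v. translate v ` F \<subseteq> decorated_segments \<D>"
    and C: "C \<in> \<C>" and D: "D \<in> \<D>"
  obtains k v where "\<And>j. j \<le> m \<Longrightarrow> D (k + int j) = shift_seg v (C (i + int j))"
proof -
  define F where "F = (\<lambda>j. decorate C (i + int j)) ` {..m}"
  have F: "finite F" "F \<subseteq> decorated_segments \<C>"
    using C by (auto simp: F_def decorated_segments_eq)
  then obtain v1 where v1: "translate v1 ` F \<subseteq> decorated_segments \<D>" using li by blast
  obtain v2 where "\<And>d. d \<in> translate v1 ` F \<Longrightarrow> \<exists>j. translate v2 d = decorate D j"
    using pattern_in_curve[OF cov lip D _ v1] F(1) by blast
  then have "\<exists>l. translate (v2 + v1) (decorate C (i + int j)) = decorate D l" if "j \<le> m" for j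
    using that unfolding F_def translate_translate[symmetric] by blast
  then obtain f where f: "\<And>j. j \<le> m \<Longrightarrow> translate (v2 + v1) (decorate C (i + int j)) = decorate D (f j)"
    by metis
  define v where "v = v2 + v1"
  have D1: "D (f j) = shift_seg v (C (i + int j))"
    "seg_support (D (f j + 1)) = (+) v ` seg_support (C (i + int j + 1))" if "j \<le> m" for j
    using f[OF that] unfolding translate_decorate v_def[symmetric] by (simp_all add: decorate_def)
  have inj: "inj (\<lambda>i. seg_support (D i))"
    using cov D by (auto simp: covering_def complete_folding_curve_def complete_curve_def)
  have "f j = f 0 + int j" if "j \<le> m" for j
    using that
  proof (induction j)
    case (Suc j)
    have "seg_support (D (f (Suc j))) = seg_support (D (f j + 1))"
      using D1(1)[of "Suc j"] D1(2)[of j] Suc.prems by (simp add: seg_support_shift ac_simps)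
    then have "f (Suc j) = f j + 1" using inj by (simp add: inj_def)
    then show ?case using Suc by simp
  qed simp
  then have "D (f 0 + int j) = shift_seg v (C (i + int j))" if "j \<le> m" for j
    using D1(1) that by metis
  then show ?thesis using that by blast
qed

lemma subwords_transfer:
  assumes "\<And>i m. \<exists>k v. \<forall>j\<le>m. D (k + int j) = shift_seg v (C (i + int j))"
  shows "subwords (assoc_seq C) \<subseteq> subwords (assoc_seq D)"
proof
  fix w assume "w \<in> subwords (assoc_seq C)"
  then obtain i m where w: "w = map (\<lambda>j. assoc_seq C (i + int j)) [0..<m]"
    unfolding subwords_eq by blast
  obtain k v where "\<And>j. j \<le> m \<Longrightarrow> D (k + int j) = shift_seg v (C (i + int j))"
    using assms by blast
  from assoc_seq_arc[of m D k v C i, OF this] have "w = map (\<lambda>j. assoc_seq D (k + int j)) [0..<m]"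
    by (simp add: w)
  then show "w \<in> subwords (assoc_seq D)" unfolding subwords_eq by blast
qed

text \<open>Nine common segments carry eight common turns, enough to locate the finest fold at the
  same place on both curves; translation preserves horizontality.\<close>

lemma same_type_transfer:
  assumes C: "complete_folding_curve C" and D: "complete_folding_curve D"
    and arc: "\<And>j. j \<le> 8 \<Longrightarrow> D (k + int j) = shift_seg v (C (i + int j))"
  shows "same_type C D"
proof -
  have cc: "complete_curve C" "complete_curve D"
    and cf: "complete_folding_seq (assoc_seq C)" "complete_folding_seq (assoc_seq D)"
    using C D by (auto simp: complete_folding_curve_def)
  obtain p c where p: "derived (assoc_seq C) p c" using complete_folding_seq_derived[OF cf(1)] .
  obtain q d where q: "derived (assoc_seq D) q d" using complete_folding_seq_derived[OF cf(2)] .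
  have "even (i - p) \<longleftrightarrow> even (k - q)"
    using derived_parity_unique[OF p q] assoc_seq_arc[of 8 D k v C i] arc by simp
  moreover have "horizontal (D k) \<longleftrightarrow> horizontal (C i)"
    using arc[of 0] by simp
  ultimately have "horizontal (C (p + 1)) \<longleftrightarrow> horizontal (D (q + 1))"
    using horizontal_parity[OF cc(1), of "p + 1" "i - (p + 1)"]
      horizontal_parity[OF cc(2), of "q + 1" "k - (q + 1)"] by auto
  then show ?thesis using same_type_iff[OF C D p q] by simp
qed

theorem theorem3p2:
  fixes \<C> \<D> :: "(int \<Rightarrow> seg) set"
  assumes "covering \<C>" and "covering \<D>"
    and "local_isomorphism_property \<C>" and "local_isomorphism_property \<D>"
  shows "locally_isomorphic \<C> \<D> \<longleftrightarrow>
    (\<forall>C \<in> \<C>. \<forall>D \<in> \<D>. same_type C D \<and> seq_locally_isomorphic (assoc_seq C) (assoc_seq D))"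
proof
  assume li: "locally_isomorphic \<C> \<D>"
  show "\<forall>C \<in> \<C>. \<forall>D \<in> \<D>. same_type C D \<and> seq_locally_isomorphic (assoc_seq C) (assoc_seq D)"
  proof (intro ballI conjI)
    fix C D assume CD: "C \<in> \<C>" "D \<in> \<D>"
    have CDf: "complete_folding_curve C" "complete_folding_curve D"
      using assms CD by (auto simp: covering_def)
    have 1: "\<exists>k v. \<forall>j\<le>m. D (k + int j) = shift_seg v (C (i + int j))" for i m
      using arc_transfer[OF assms(2,4) _ CD, of m i] li unfolding locally_isomorphic_def by metis
    have 2: "\<exists>k v. \<forall>j\<le>m. C (k + int j) = shift_seg v (D (i + int j))" for i m
      using arc_transfer[OF assms(1,3) _ CD(2,1), of m i] li unfolding locally_isomorphic_def by metis
    show "same_type C D" using same_type_transfer[OF CDf] 1[of 8] by blast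
    show "seq_locally_isomorphic (assoc_seq C) (assoc_seq D)"
      unfolding seq_locally_isomorphic_def
      using subwords_transfer[of D C, OF 1] subwords_transfer[of C D, OF 2] by blast
  qed
next
  assume R: "\<forall>C \<in> \<C>. \<forall>D \<in> \<D>. same_type C D \<and> seq_locally_isomorphic (assoc_seq C) (assoc_seq D)"
  \<comment> \<open>One curve from each covering suffices, since it already contains every finite
    pattern of its covering.\<close>
  obtain C where C: "C \<in> \<C>" using covering_nonempty[OF assms(1)] .
  obtain D where D: "D \<in> \<D>" using covering_nonempty[OF assms(2)] .
  have CDf: "complete_folding_curve C" "complete_folding_curve D"
    using assms C D by (auto simp: covering_def)
  have CD: "same_type C D" "same_type D C" "subwords (assoc_seq C) = subwords (assoc_seq D)"
    using R C D by (auto simp: same_type_def seq_locally_isomorphic_def)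
  show "locally_isomorphic \<C> \<D>"
    unfolding locally_isomorphic_def
    using pattern_transfer[OF assms(1,3) C D CDf(2) CD(1)]
      pattern_transfer[OF assms(2,4) D C CDf(1) CD(2)] CD(3) by blast
qed

end
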